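(* Let $q\in\mathbb{C}$ with $0<|q|<1$. (1) If $w\in\mathbb{C}$ with $|w|>1$ and $w\neq q^{2\ell+1}$ for all $\ell\in\mathbb{N}_0$, then $$\kappa(w;q^{-1})=\frac{1}{1-w}\,\psi_2(w^{-1};q).$$ (2) If $w\in\mathbb{C}\setminus\{0,1\}$ and $w\neq q^{2\ell+1}$ for all $\ell\in\mathbb{Z}$, then $$K_1(w;q^{-1})=\frac{w}{w-1}\bigl(\psi_2(w;q)+s_1(w;q)\bigr).$$ (3) If $w\in\mathbb{C}\setminus\{0\}$ and $w\neq q^{2\ell}$ for all $\ell\in\mathbb{Z}\setminus\{0\}$, then $$K(w;q^{-1})=(1-w)\,\psi_2(w;q)+S_5(w;q).$$
   Context: Notation: for any base $p\in\mathbb{C}\setminus\{0\}$, $(a;p)_n:=\prod_{j=0}^{n-1}(1-ap^j)$ for $n\in\mathbb{N}_0$, and $(a_1,\dots,a_r;p)_n:=(a_1;p)_n\cdots(a_r;p)_n$; for $|p|<1$ also $(a;p)_\infty:=\prod_{j\ge0}(1-ap^j)$ and similarly for several arguments. $\mathbb{N}_0=\{0,1,2,\dots\}$, and $\left(\frac{\cdot}{\cdot}\right)$ is the Kronecker symbol. For $p$ with $|p|\neq1$, define by the following series (for $p=q^{-1}$ one uses the same series, with every occurrence of $p$ equal to $q^{-1}$): $$K(w;p):=\sum_{n\ge0}\frac{(-1)^np^{n^2}(p;p^2)_n}{(wp^2,w^{-1}p^2;p^2)_n},\qquad K_1(w;p):=\sum_{n\ge1}\frac{(-1)^{n-1}p^{n^2}(p;p^2)_{n-1}}{(wp,w^{-1}p;p^2)_n},$$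 $$\kappa(w;p):=\sum_{n\ge0}\frac{p^{n+1}w^{-n}(wp^2;p^2)_n}{(wp;p^2)_{n+1}}.$$ For $|q|<1$ define $$\psi_1(w;q):=-w-w^2\sum_{n\ge0}\left(\frac{12}{n}\right)w^{\frac{n-1}{2}}q^{\frac{n^2-1}{24}},\qquad \psi_2(w;q):=\sum_{n\ge0}w^nq^{\frac{n(n+1)}2},$$ $$\psi_5(w;q):=\sum_{n\ge0}\left(\frac n3\right)(-w)^{n-1}q^{\frac{n^2-1}3}$$ (the Kronecker symbols vanish whenever an exponent would be non-integral, and at $n=0$). For $w\neq0$, $w\neq q^{2\ell+1}$ $(\ell\in\mathbb{Z})$ define $$s_1(w;q):=\frac{(q;q^2)_\infty}{w\,(wq,w^{-1}q;q^2)_\infty}\left(w^{-1}\psi_1(w;q^2)+1\right),$$ and for $w\ne0$, $w\neq q^{2\ell}$ $(\ell\in\mathbb{Z}\setminus\{0\})$ define $$S_5(w;q):=\frac{w\,(q;q^2)_\infty}{(wq^2,w^{-1}q^2;q^2)_\infty}\,\psi_5(w;q).$$ *)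

theory Defs
  imports "HOL-Analysis.Analysis" "HOL-Number_Theory.Number_Theory"
begin

definition qpoch :: "complex \<Rightarrow> complex \<Rightarrow> nat \<Rightarrow> complex" where
  "qpoch a p n = (\<Prod>j<n. 1 - a * p ^ j)"

text \<open>Only meaningful for \<open>norm p < 1\<close>; a vanishing factor makes the whole product \<open>0\<close>, as usual.\<close>
definition qpoch_inf :: "complex \<Rightarrow> complex \<Rightarrow> complex" where
  "qpoch_inf a p = (\<Prod>j. 1 - a * p ^ j)"

definition kronecker_prime :: "int \<Rightarrow> int \<Rightarrow> int" where
  "kronecker_prime a p =
     (if p = 2 then (if even a then 0 else if a mod 8 = 1 \<or> a mod 8 = 7 then 1 else -1)
      else Legendre a p)"

text \<open>The Kronecker symbol \<open>(a/n)\<close>. The leading factor is the value \<open>(a/u)\<close> at the unit \<open>u = sgn n\<close>.\<close>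
definition kronecker :: "int \<Rightarrow> int \<Rightarrow> int" where
  "kronecker a n =
     (if n = 0 then (if \<bar>a\<bar> = 1 then 1 else 0)
      else (if n < 0 \<and> a < 0 then -1 else 1) *
           (\<Prod>p\<in>prime_factors n. kronecker_prime a p ^ multiplicity p n))"

definition K :: "complex \<Rightarrow> complex \<Rightarrow> complex" where
  "K w p = (\<Sum>n. (-1) ^ n * p ^ n\<^sup>2 * qpoch p (p\<^sup>2) n /
                   (qpoch (w * p\<^sup>2) (p\<^sup>2) n * qpoch (inverse w * p\<^sup>2) (p\<^sup>2) n))"

text \<open>The sum over \<open>m \<ge> 1\<close> is indexed by \<open>m = Suc n\<close>.\<close>
definition K1 :: "complex \<Rightarrow> complex \<Rightarrow> complex" where
  "K1 w p = (\<Sum>n. (-1) ^ n * p ^ (Suc n)\<^sup>2 * qpoch p (p\<^sup>2) n /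
                    (qpoch (w * p) (p\<^sup>2) (Suc n) * qpoch (inverse w * p) (p\<^sup>2) (Suc n)))"

definition kappa :: "complex \<Rightarrow> complex \<Rightarrow> complex" where
  "kappa w p = (\<Sum>n. p ^ (n + 1) * inverse w ^ n * qpoch (w * p\<^sup>2) (p\<^sup>2) n /
                       qpoch (w * p) (p\<^sup>2) (n + 1))"

text \<open>
  In \<open>psi1\<close> and \<open>psi5\<close> the exponents are natural numbers with truncating subtraction and
  division. Both operations are exact wherever the Kronecker symbol is nonzero, that is, for
  \<open>n\<close> coprime to \<open>12\<close> and to \<open>3\<close>, respectively; all other terms, including \<open>n = 0\<close>, vanish.
\<close>
definition psi1 :: "complex \<Rightarrow> complex \<Rightarrow> complex" where
  "psi1 w q = - w - w\<^sup>2 *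
     (\<Sum>n. of_int (kronecker 12 (int n)) * w ^ ((n - 1) div 2) * q ^ ((n\<^sup>2 - 1) div 24))"

definition psi2 :: "complex \<Rightarrow> complex \<Rightarrow> complex" where
  "psi2 w q = (\<Sum>n. w ^ n * q ^ (n * (n + 1) div 2))"

definition psi5 :: "complex \<Rightarrow> complex \<Rightarrow> complex" where
  "psi5 w q =
     (\<Sum>n. of_int (kronecker (int n) 3) * (- w) ^ (n - 1) * q ^ ((n\<^sup>2 - 1) div 3))"

definition s1 :: "complex \<Rightarrow> complex \<Rightarrow> complex" where
  "s1 w q = qpoch_inf q (q\<^sup>2) /
     (w * (qpoch_inf (w * q) (q\<^sup>2) * qpoch_inf (inverse w * q) (q\<^sup>2))) *
     (inverse w * psi1 w (q\<^sup>2) + 1)"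

definition S5 :: "complex \<Rightarrow> complex \<Rightarrow> complex" where
  "S5 w q = w * qpoch_inf q (q\<^sup>2) /
     (qpoch_inf (w * q\<^sup>2) (q\<^sup>2) * qpoch_inf (inverse w * q\<^sup>2) (q\<^sup>2)) * psi5 w q"

end

theory Submission
  imports Defs
begin

text \<open>
  Rewriting the three series in base \<open>q\<close> turns them into convergent sums, to be compared with partial
  theta functions. Up to an elementary factor (and with \<open>1/w\<close> for \<open>w\<close> in (1)), each right-hand side \<open>R\<close> satisfies
  \<open>R(w) = I(w) + w\<^sup>2 q\<^sup>3 R(w q\<^sup>2)\<close>, which comes from shifting the summation index of the theta series.
  Each left-hand side satisfies the same equation: its terms obey
  \<open>T\<^sub>m(w) - w\<^sup>2 q\<^sup>3 T\<^sub>m(w q\<^sup>2) = G\<^sub>m\<^sub>+\<^sub>1 - G\<^sub>m\<close> with an explicit \<open>G\<close>, and \<open>lim G\<^sub>m - G\<^sub>0\<close> supplies \<open>I(w)\<close>,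
  including the infinite-product term. Both sides grow at most geometrically along \<open>w q\<^bsup>2n\<^esup>\<close>, whereas the
  homogeneous equation would force their difference to grow like \<open>q\<^bsup>-2n\<^sup>2\<^esup>\<close>; so they agree.
\<close>

section \<open>Kronecker symbols with modulus 3 and 12\<close>

lemma Legendre_mod_left: "Legendre (a mod p) p = Legendre a p"
  by (simp add: Legendre_def QuadRes_def cong_def)

lemma kronecker_3: "kronecker a 3 = (if a mod 3 = 0 then 0 else if a mod 3 = 1 then 1 else - 1)"
proof -
  have p3: "prime (3::int)" by simp
  have "kronecker a 3 = Legendre (a mod 3) 3"
    by (simp add: kronecker_def kronecker_prime_def prime_factorization_prime[OF p3] Legendre_mod_left)
  moreover have "a mod 3 = 0 \<or> a mod 3 = 1 \<or> a mod 3 = 2" by presburger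
  moreover have "Legendre 0 3 = 0" by (simp add: Legendre_def)
  moreover have "Legendre 1 3 = 1"
    unfolding Legendre_def QuadRes_def cong_def by (auto intro: exI[of _ 1])
  moreover have "Legendre 2 3 = -1"
  proof -
    have "y\<^sup>2 mod 3 \<noteq> 2" for y :: int
    proof -
      have "y mod 3 = 0 \<or> y mod 3 = 1 \<or> y mod 3 = 2" by presburger
      moreover have "y\<^sup>2 mod 3 = (y mod 3)\<^sup>2 mod 3" by (simp add: power_mod)
      ultimately show ?thesis by auto
    qed
    then show ?thesis unfolding Legendre_def QuadRes_def cong_def by auto
  qed
  ultimately show ?thesis by auto
qed

text \<open>The even primitive Dirichlet character modulo 12, attached to the field Q(sqrt
  3).\<close>

definition chi12 :: "int \<Rightarrow> int" where
  "chi12 n = (if n mod 12 \<in> {1, 11} then 1 else if n mod 12 \<in> {5, 7} then - 1 else 0)"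

lemma mod_12_cases:
  fixes n :: int
  obtains "n mod 12 = 0" | "n mod 12 = 1" | "n mod 12 = 2" | "n mod 12 = 3" | "n mod 12 = 4" |
    "n mod 12 = 5" | "n mod 12 = 6" | "n mod 12 = 7" | "n mod 12 = 8" | "n mod 12 = 9" |
    "n mod 12 = 10" | "n mod 12 = 11"
  by (smt (verit) pos_mod_sign pos_mod_bound)

text \<open>This antiperiodicity is why \<open>pentagonal_series\<close> obeys a recurrence under an
  index shift by 6, half the period of the character, and it is the source of the minus sign
  there.\<close>

lemma chi12_add_6: "chi12 (n + 6) = - chi12 n"
proof -
  have "(n + 6) mod 12 = (n mod 12 + 6) mod 12" by (simp add: mod_simps)
  then show ?thesis by (cases n rule: mod_12_cases) (simp_all add: chi12_def)
qed

lemma chi12_mult: "chi12 (a * b) = chi12 a * chi12 b"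
proof -
  define r s where "r = a mod 12" and "s = b mod 12"
  \<comment> \<open>A finite check over the 144 pairs of residues.\<close>
  have "chi12 (r * s) = chi12 r * chi12 s"
    by (rule mod_12_cases[of a, folded r_def]; rule mod_12_cases[of b, folded s_def])
      (simp_all add: chi12_def)
  moreover have "chi12 (a * b) = chi12 (r * s)" by (simp add: chi12_def r_def s_def mod_mult_eq)
  moreover have "chi12 a = chi12 r" "chi12 b = chi12 s" by (simp_all add: chi12_def r_def s_def)
  ultimately show ?thesis by simp
qed

lemma chi12_1 [simp]: "chi12 1 = 1"
  by (simp add: chi12_def)

lemma chi12_power: "chi12 (a ^ n) = chi12 a ^ n"
  by (induction n) (auto simp: chi12_mult)

lemma chi12_prod: "chi12 (prod f A) = (\<Prod>x\<in>A. chi12 (f x))"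
  by (induction A rule: infinite_finite_induct) (auto simp: chi12_mult)

text \<open>Modulo \<open>p\<close>, 12 is 3 times the square of the unit 2, so multiplying a square
  root by 2 or by its inverse \<open>u\<close> carries solvability across.\<close>

lemma Legendre_12_eq_Legendre_3:
  assumes p: "prime p" "3 < p"
  shows "Legendre 12 p = Legendre 3 p"
proof -
  have co: "coprime 2 p" using p by (simp add: prime_odd_int)
  then obtain u where u: "[2 * u = 1] (mod p)" using cong_solve_coprime_int[OF co] by blast
  have "QuadRes p 12 \<longleftrightarrow> QuadRes p 3"
  proof
    assume "QuadRes p 12"
    then obtain y where "[y\<^sup>2 = 12] (mod p)" unfolding QuadRes_def by blast
    then have "[u\<^sup>2 * y\<^sup>2 = u\<^sup>2 * 12] (mod p)" by (rule cong_scalar_left)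
    moreover have "[(2 * u)\<^sup>2 * 3 = 1\<^sup>2 * 3] (mod p)" using u by (intro cong_mult cong_pow) auto
    ultimately have "[(u * y)\<^sup>2 = 3] (mod p)"
      by (simp add: power_mult_distrib mult.commute) (metis cong_trans)
    then show "QuadRes p 3" unfolding QuadRes_def by blast
  next
    assume "QuadRes p 3"
    then obtain y where "[y\<^sup>2 = 3] (mod p)" unfolding QuadRes_def by blast
    then have "[2\<^sup>2 * y\<^sup>2 = 2\<^sup>2 * 3] (mod p)" by (rule cong_scalar_left)
    then have "[(2 * y)\<^sup>2 = 12] (mod p)" by (simp add: power_mult_distrib)
    then show "QuadRes p 12" unfolding QuadRes_def by blast
  qed
  moreover have "[12 = 0] (mod p) \<longleftrightarrow> [3 = 0] (mod p)"
  proof -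
    have "p dvd 2 * (2 * 3) \<longleftrightarrow> p dvd 3"
      using p co by (metis coprime_commute coprime_dvd_mult_right_iff)
    then show ?thesis by (simp add: cong_0_iff)
  qed
  ultimately show ?thesis by (simp add: Legendre_def)
qed

text \<open>For p > 3, quadratic reciprocity turns (3/p) into (p/3) times the sign (-1)^((p-1)/2);
  the former depends on p modulo 3, the latter on p modulo 4. The primes 2 and 3 divide 12, and both
  sides vanish there.\<close>

lemma kronecker_prime_12:
  assumes p: "prime p"
  shows "kronecker_prime 12 p = chi12 p"
proof -
  consider "p = 2" | "p = 3" | "3 < p"
    using prime_ge_2_int[OF p] by linarith
  then show ?thesis
  proof cases
    case 3
    have np: "prime (nat p)" using p prime_int_nat_transfer by blast
    have "m = 1 \<or> m = p" if "m dvd p" "0 \<le> m" for m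
      using p that by (simp add: prime_int_iff)
    from this[of 2] this[of 3] have "\<not> 2 dvd p" "\<not> 3 dvd p" using 3 by auto
    then have c: "p mod 12 = 1 \<or> p mod 12 = 5 \<or> p mod 12 = 7 \<or> p mod 12 = 11" by presburger
    have "Legendre 3 p * Legendre p 3 = (- 1) ^ nat ((3 - 1) div 2 * ((p - 1) div 2))"
      using np 3 by (intro Quadratic_Reciprocity_int) auto
    then have rec: "Legendre 3 p * Legendre p 3 = (- 1) ^ nat ((p - 1) div 2)" by simp
    have "Legendre p 3 = kronecker p 3"
    proof -
      have p3: "prime (3::int)" by simp
      then show ?thesis by (simp add: kronecker_def kronecker_prime_def prime_factorization_prime[OF p3])
    qed
    then have L: "Legendre p 3 = (if p mod 3 = 1 then 1 else - 1)"
      using \<open>\<not> 3 dvd p\<close> by (simp add: kronecker_3 dvd_eq_mod_eq_0)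
    have k: "p = 12 * (p div 12) + p mod 12" by simp
    have mod3: "p mod 3 = p mod 12 mod 3" by (simp add: mod_mod_cancel)
    have sgn: "(- 1) ^ nat ((p - 1) div 2) = (if even ((p - 1) div 2) then 1 else - 1 :: int)"
      using 3 by (simp add: minus_one_power_iff even_nat_iff)
    have "Legendre 3 p = chi12 p"
      using c
    proof (elim disjE)
      assume m: "p mod 12 = 1"
      then have "(p - 1) div 2 = 6 * (p div 12) + 0" using k by linarith
      then have "even ((p - 1) div 2)" by simp
      moreover have "p mod 3 = 1" using mod3 m by simp
      ultimately show ?thesis using rec L sgn m by (simp add: chi12_def)
    next
      assume m: "p mod 12 = 5"
      then have "(p - 1) div 2 = 6 * (p div 12) + 2" using k by linarith
      then have "even ((p - 1) div 2)" by simp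
      moreover have "p mod 3 = 2" using mod3 m by simp
      ultimately show ?thesis using rec L sgn m by (simp add: chi12_def)
    next
      assume m: "p mod 12 = 7"
      then have "(p - 1) div 2 = 6 * (p div 12) + 3" using k by linarith
      then have "odd ((p - 1) div 2)" by simp
      moreover have "p mod 3 = 1" using mod3 m by simp
      ultimately show ?thesis using rec L sgn m by (simp add: chi12_def)
    next
      assume m: "p mod 12 = 11"
      then have "(p - 1) div 2 = 6 * (p div 12) + 5" using k by linarith
      then have "odd ((p - 1) div 2)" by simp
      moreover have "p mod 3 = 2" using mod3 m by simp
      ultimately show ?thesis using rec L sgn m by (simp add: chi12_def)
    qed
    then show ?thesis using 3 Legendre_12_eq_Legendre_3[OF p 3] by (simp add: kronecker_prime_def)
  qed (auto simp: kronecker_prime_def chi12_def Legendre_def cong_def)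
qed

text \<open>Multiplicativity of \<open>chi12\<close> reduces the claim to the primes, settled by
  \<open>kronecker_prime_12\<close>; at n = 0 both sides vanish.\<close>

lemma kronecker_12:
  "kronecker 12 (int n) = chi12 (int n)"
proof (cases "n = 0")
  case False
  then have "kronecker 12 (int n) =
    (\<Prod>p\<in>prime_factors (int n). kronecker_prime 12 p ^ multiplicity p (int n))"
    by (simp add: kronecker_def)
  also have "\<dots> = (\<Prod>p\<in>prime_factors (int n). chi12 (p ^ multiplicity p (int n)))"
    by (intro prod.cong refl) (simp add: chi12_power kronecker_prime_12[OF in_prime_factors_imp_prime])
  also have "\<dots> = chi12 (\<Prod>p\<in>prime_factors (int n). p ^ multiplicity p (int n))"
    by (simp add: chi12_prod)
  also have "(\<Prod>p\<in>prime_factors (int n). p ^ multiplicity p (int n)) = int n"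
    using False by (subst prod_prime_factors) auto
  finally show ?thesis .
qed (simp add: kronecker_def chi12_def)


section \<open>q-Pochhammer symbols\<close>

lemma qpoch_0 [simp]: "qpoch a p 0 = 1"
  by (simp add: qpoch_def)

lemma qpoch_Suc: "qpoch a p (Suc n) = qpoch a p n * (1 - a * p ^ n)"
  by (simp add: qpoch_def)

text \<open>Each factor satisfies 1 - 1/(a q^(2j)) = - (1 - a q^(2j)) / (a q^(2j)), and the product
  of the a q^(2j) is a^n q^(n(n-1)). The extra q^n on both sides avoids the exponent n(n-1).\<close>

lemma qpoch_inverse_base:
  assumes "a \<noteq> 0" "q \<noteq> 0"
  shows "qpoch (inverse a) ((inverse q)\<^sup>2) n * (a ^ n * q ^ (n * n)) = (- 1) ^ n * q ^ n * qpoch a (q\<^sup>2) n"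
proof (induction n)
  case (Suc n)
  define x where "x = (q\<^sup>2) ^ n"
  have x: "x \<noteq> 0" "((inverse q)\<^sup>2) ^ n = inverse x" using assms by (auto simp: x_def power_inverse)
  have e1: "(1 - inverse a * ((inverse q)\<^sup>2) ^ n) * (a * x) = - (1 - a * x)"
    unfolding x(2) using assms x(1) by (simp add: field_simps)
  have e2: "q ^ (Suc n * Suc n) = q ^ (n * n) * x * q"
    by (simp add: x_def power_add power_mult[symmetric] mult_2 mult_2_right algebra_simps)
  have e3: "qpoch (inverse a) ((inverse q)\<^sup>2) (Suc n) * (a ^ Suc n * (q ^ (n * n) * x * q)) =
    (qpoch (inverse a) ((inverse q)\<^sup>2) n * (a ^ n * q ^ (n * n))) *
      ((1 - inverse a * ((inverse q)\<^sup>2) ^ n) * (a * x)) * q"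
    unfolding qpoch_Suc power_Suc by (simp only: mult_ac)
  have "qpoch (inverse a) ((inverse q)\<^sup>2) (Suc n) * (a ^ Suc n * q ^ (Suc n * Suc n)) =
    (qpoch (inverse a) ((inverse q)\<^sup>2) n * (a ^ n * q ^ (n * n))) * (- (1 - a * x)) * q"
    by (simp only: e1 e2 e3)
  then show ?case unfolding Suc by (simp add: qpoch_Suc x_def algebra_simps)
qed simp

lemma qpoch_has_prod:
  assumes "norm p < 1"
  shows "(\<lambda>j. 1 - a * p ^ j) has_prod qpoch_inf a p"
proof -
  have "summable (\<lambda>j. norm ((1 - a * p ^ j) - 1))"
    using assms by (auto simp: norm_mult norm_power intro!: summable_mult summable_geometric)
  then have "abs_convergent_prod (\<lambda>j. 1 - a * p ^ j)" by (rule summable_imp_abs_convergent_prod)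
  then show ?thesis unfolding qpoch_inf_def
    by (intro convergent_prod_has_prod abs_convergent_prod_imp_convergent_prod)
qed

lemma qpoch_LIMSEQ:
  assumes "norm p < 1"
  shows "qpoch a p \<longlonglongrightarrow> qpoch_inf a p"
  using has_prod_imp_tendsto'[OF qpoch_has_prod[OF assms]] by (simp add: qpoch_def[abs_def])

lemma qpoch_inf_nonzero:
  assumes "norm p < 1" "\<And>j. a * p ^ j \<noteq> 1"
  shows "qpoch_inf a p \<noteq> 0"
  using has_prod_eq_0_iff[OF qpoch_has_prod[OF assms(1)], of a] assms(2) by (auto simp: image_iff)

text \<open>The factors tend to 1, so only finitely many have norm below 1/2, and none vanishes.
  Since the shifts move along the orbit w p^j, a single \<open>d\<close> bounds the denominators of
  all shifted series.\<close>

lemma geometric_away_from_1: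
  fixes w p :: complex
  assumes "norm p < 1" "\<And>j. w * p ^ j \<noteq> 1"
  obtains d where "0 < d" "\<And>j. d \<le> norm (1 - w * p ^ j)"
proof -
  have "(\<lambda>j. norm (1 - w * p ^ j)) \<longlonglongrightarrow> norm (1 - w * 0)"
    using assms by (intro tendsto_intros LIMSEQ_power_zero)
  then have "eventually (\<lambda>j. 1 / 2 < norm (1 - w * p ^ j)) sequentially"
    by (rule order_tendstoD) simp
  then obtain N where N: "\<And>j. N \<le> j \<Longrightarrow> 1 / 2 < norm (1 - w * p ^ j)"
    by (auto simp: eventually_sequentially)
  define d where "d = Min (insert (1/2) ((\<lambda>j. norm (1 - w * p ^ j)) ` {..<N}))"
  show ?thesis
  proof
    show "0 < d" unfolding d_def using assms(2) by (subst Min_gr_iff) (auto simp: right_minus_eq)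
    show "d \<le> norm (1 - w * p ^ j)" for j
    proof (cases "j < N")
      case True then show ?thesis unfolding d_def by (intro Min_le) auto
    next
      case False
      have "d \<le> 1/2" unfolding d_def by (intro Min_le) auto
      then show ?thesis using N[of j] False by linarith
    qed
  qed
qed

section \<open>Lacunary series and telescoping recurrences\<close>

text \<open>Once \<open>M\<close> is chosen with B r^M < 1/2, the terms are eventually dominated by
  a geometric series of ratio 1/2.\<close>

lemma summable_superlinear_exponent:
  fixes B r :: real
  assumes "0 \<le> B" "0 \<le> r" "r < 1" "\<And>M. \<exists>N. \<forall>n\<ge>N. M * n \<le> f n"
  shows "summable (\<lambda>n. B ^ n * r ^ f n)"
proof -
  have "(\<lambda>M. B * r ^ M) \<longlonglongrightarrow> B * 0"
    using assms by (intro tendsto_intros LIMSEQ_power_zero) auto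
  then have "eventually (\<lambda>M. B * r ^ M < 1 / 2) sequentially"
    by (rule order_tendstoD) simp
  then obtain M where M: "B * r ^ M < 1 / 2" by (auto simp: eventually_sequentially)
  obtain N where N: "\<And>n. N \<le> n \<Longrightarrow> M * n \<le> f n" using assms(4) by blast
  show ?thesis
  proof (rule summable_comparison_test')
    show "summable (\<lambda>n. (1 / 2 :: real) ^ n)" by (intro summable_geometric) auto
    fix n assume "N \<le> n"
    then have "r ^ f n \<le> r ^ (M * n)" using assms N by (intro power_decreasing) auto
    then have "B ^ n * r ^ f n \<le> (B * r ^ M) ^ n"
      using assms by (simp add: power_mult_distrib power_mult[symmetric] mult_left_mono)
    also have "\<dots> \<le> (1 / 2) ^ n" using M assms by (intro power_mono) auto
    finally show "norm (B ^ n * r ^ f n) \<le> (1 / 2) ^ n" using assms by simp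
  qed
qed

text \<open>The majorant (max 1 r)^n |q|^(f n) does not depend on w, so the bound is uniform on the
  disc. Uniformity matters because the whole orbit w q^(2n) lies in one disc.\<close>

lemma lacunary_series_bounded:
  fixes c :: "nat \<Rightarrow> complex" and q :: complex
  assumes c: "\<And>n. norm (c n) \<le> 1" and e: "\<And>n. e n \<le> n" and q: "norm q < 1"
    and f: "\<And>M. \<exists>N. \<forall>n\<ge>N. M * n \<le> f n"
  shows "\<exists>C. \<forall>w. norm w \<le> r \<longrightarrow> summable (\<lambda>n. c n * w ^ e n * q ^ f n) \<and>
    norm (\<Sum>n. c n * w ^ e n * q ^ f n) \<le> C"
proof -
  define g where "g n = (max 1 r) ^ n * norm q ^ f n" for n
  have g: "summable g" unfolding g_def using q f by (intro summable_superlinear_exponent) auto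
  have le: "norm (c n * w ^ e n * q ^ f n) \<le> g n" if "norm w \<le> r" for w n
  proof -
    have "norm w ^ e n \<le> max 1 r ^ e n" using that by (intro power_mono) auto
    also have "\<dots> \<le> max 1 r ^ n" using e by (intro power_increasing) auto
    finally have "norm (c n) * norm w ^ e n \<le> 1 * max 1 r ^ n" using c by (intro mult_mono) auto
    then show ?thesis unfolding g_def norm_mult norm_power by (intro mult_right_mono) auto
  qed
  show ?thesis
  proof (intro exI allI impI conjI)
    fix w :: complex assume w: "norm w \<le> r"
    show "summable (\<lambda>n. c n * w ^ e n * q ^ f n)"
      by (rule summable_comparison_test'[OF g]) (rule le[OF w])
    show "norm (\<Sum>n. c n * w ^ e n * q ^ f n) \<le> suminf g"
      by (rule norm_suminf_le[OF le[OF w] g])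
  qed
qed

text \<open>Beyond the index where |W n| < 1/(2B), expressing D N through D (N + m) gains (2B)^(-m)
  against a growth of only B^m. Letting m grow gives D N = 0.\<close>

lemma geometric_times_superexponential_0:
  fixes D W :: "nat \<Rightarrow> complex"
  assumes B: "0 < B" and W: "W \<longlonglongrightarrow> 0"
    and D: "\<And>n. D n = W n * D (Suc n)" and bd: "\<And>n. norm (D n) \<le> C * B ^ n"
  shows "D 0 = 0"
proof -
  have C: "0 \<le> C" using order_trans[OF norm_ge_zero bd[of 0]] by simp
  have "eventually (\<lambda>n. norm (W n) < 1 / (2 * B)) sequentially"
    using W[THEN tendsto_norm] B by (intro order_tendstoD) auto
  then obtain N where N: "\<And>n. N \<le> n \<Longrightarrow> norm (W n) < 1 / (2 * B)"
    by (auto simp: eventually_sequentially)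
  have "norm (D N) \<le> C * B ^ N * (1 / 2) ^ m" for m
  proof -
    have "norm (D N) \<le> (1 / (2 * B)) ^ m * norm (D (N + m))"
    proof (induction m)
      case (Suc m)
      have "norm (D (N + m)) = norm (W (N + m)) * norm (D (N + Suc m))"
        by (subst D) (simp add: norm_mult)
      also have "\<dots> \<le> 1 / (2 * B) * norm (D (N + Suc m))"
        using N[of "N + m"] by (intro mult_right_mono) auto
      finally show ?case using Suc B
        by (smt (verit, ccfv_SIG) mult_left_mono mult.assoc mult.commute power_Suc zero_le_power divide_nonneg_pos)
    qed simp
    also have "\<dots> \<le> (1 / (2 * B)) ^ m * (C * B ^ (N + m))"
      using bd B by (intro mult_left_mono) auto
    also have "\<dots> = C * B ^ N * (1 / 2) ^ m"
      using B by (simp add: power_add power_divide power_mult_distrib)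
    finally show ?thesis .
  qed
  moreover have "(\<lambda>m. C * B ^ N * (1 / 2) ^ m) \<longlonglongrightarrow> C * B ^ N * 0"
    by (intro tendsto_intros LIMSEQ_power_zero) auto
  ultimately have "norm (D N) \<le> 0"
    by (intro LIMSEQ_le_const[of _ 0]) auto
  then have DN: "D N = 0" by simp
  \<comment> \<open>Zero travels down from N to 0, because each D n is a multiple of D (Suc
    n).\<close>
  have "D (N - k) = 0" for k
  proof (induction k)
    case (Suc k)
    show ?case
    proof (cases "k < N")
      case True
      then have "D (N - Suc k) = W (N - Suc k) * D (N - k)" by (subst D) (simp add: Suc_diff_Suc)
      then show ?thesis using Suc by simp
    next
      case False then show ?thesis using Suc by simp
    qed
  qed (use DN in simp)
  from this[of N] show ?thesis by simp
qed

text \<open>The common engine of the three summations: n counts the shifts of w and m is the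
  summation index. Summing \<open>tel\<close> over m shows that the sums of T n satisfy the same
  recurrence as R, so their difference solves the homogeneous one. The bound on T gives both
  convergence and geometric growth of the sums.\<close>

lemma telescoping_recurrence:
  fixes T G :: "nat \<Rightarrow> nat \<Rightarrow> complex"
  assumes B: "0 < B" and W: "W \<longlonglongrightarrow> 0"
    and M: "summable M" and T: "\<And>n m. norm (T n m) \<le> B ^ n * M m"
    and tel: "\<And>n m. T n m - W n * T (Suc n) m = G n (Suc m) - G n m"
    and L: "\<And>n. G n \<longlonglongrightarrow> L n"
    and R: "\<And>n. R n = L n - G n 0 + W n * R (Suc n)"
    and RC: "\<And>n. norm (R n) \<le> C * A ^ n" and A: "0 < A"
  shows "T 0 sums R 0"
proof -
  have sT: "summable (T n)" for n
    by (rule summable_comparison_test'[OF summable_mult[OF M]]) (rule T)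
  define S where "S n = suminf (T n)" for n
  have S: "S n = L n - G n 0 + W n * S (Suc n)" for n
  proof -
    have "(\<lambda>m. G n (Suc m) - G n m) sums (L n - G n 0)" using L by (rule telescope_sums)
    moreover have "(\<lambda>m. T n m - W n * T (Suc n) m) sums (S n - W n * S (Suc n))"
      unfolding S_def using sT by (intro sums_diff sums_mult summable_sums)
    ultimately show ?thesis unfolding tel by (auto dest: sums_unique2)
  qed
  have "S 0 - R 0 = 0"
  proof (rule geometric_times_superexponential_0[where D = "\<lambda>n. S n - R n" and C = "suminf M + C"])
    \<comment> \<open>\<open>max A B\<close> is a single geometric rate dominating both S and
      R.\<close>
    show "0 < max A B" using B by simp
    show "W \<longlonglongrightarrow> 0" by (rule W)
    show "S n - R n = W n * (S (Suc n) - R (Suc n))" for n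
      by (subst S, subst R) (simp add: algebra_simps)
    fix n
    have C: "0 \<le> C" using order_trans[OF norm_ge_zero RC[of 0]] by simp
    have "0 \<le> M m" for m using order_trans[OF norm_ge_zero T[of 0 m]] by simp
    then have M0: "0 \<le> suminf M" using M by (intro suminf_nonneg)
    have "norm (S n) \<le> (\<Sum>m. B ^ n * M m)" unfolding S_def
      by (rule norm_suminf_le[OF T summable_mult[OF M]])
    also have "\<dots> = suminf M * B ^ n" using M by (simp add: suminf_mult)
    also have "\<dots> \<le> suminf M * max A B ^ n" using B M0 by (intro mult_left_mono power_mono) auto
    finally have 1: "norm (S n) \<le> suminf M * max A B ^ n" .
    have "norm (R n) \<le> C * max A B ^ n"
      using A C by (intro order.trans[OF RC] mult_left_mono power_mono) auto
    then show "norm (S n - R n) \<le> (suminf M + C) * max A B ^ n"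
      using 1 norm_triangle_ineq4[of "S n" "R n"] by (simp add: algebra_simps)
  qed
  then show ?thesis using summable_sums[OF sT[of 0]] by (simp add: S_def)
qed


lemma suminf_shift:
  fixes f :: "nat \<Rightarrow> complex"
  assumes "summable f" "summable g" "\<And>n. f (n + k) = c * g n"
  shows "suminf f = (\<Sum>i<k. f i) + c * suminf g"
  using suminf_split_initial_segment[OF assms(1), of k] assms(2,3) by (simp add: suminf_mult)

lemma superlinear_square_div:
  fixes d M :: nat
  assumes "0 < d"
  shows "\<exists>N. \<forall>n\<ge>N. M * n \<le> (n\<^sup>2 - 1) div d"
proof (intro exI allI impI)
  fix n :: nat assume n: "d * M + 1 \<le> n"
  then have "d * M * n \<le> (n - 1) * n" by (intro mult_right_mono) auto
  also have "\<dots> \<le> n\<^sup>2 - 1" using n by (simp add: power2_eq_square diff_mult_distrib)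
  finally show "M * n \<le> (n\<^sup>2 - 1) div d" using assms by (simp add: less_eq_div_iff_mult_less_eq mult_ac)
qed

lemma superlinear_triangular:
  fixes M :: nat
  shows "\<exists>N. \<forall>n\<ge>N. M * n \<le> n * (n + 1) div 2"
proof (intro exI allI impI)
  fix n :: nat assume n: "2 * M \<le> n"
  then have "(2 * M) * n \<le> (n + 1) * n" by (intro mult_right_mono) auto
  then show "M * n \<le> n * (n + 1) div 2" by (simp add: less_eq_div_iff_mult_less_eq mult_ac)
qed

section \<open>Functional equations of the theta series\<close>

lemma psi2_bounded:
  assumes "norm q < 1"
  shows "\<exists>C. \<forall>w. norm w \<le> r \<longrightarrow>
    summable (\<lambda>n. w ^ n * q ^ (n * (n + 1) div 2)) \<and> norm (psi2 w q) \<le> C"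
  using lacunary_series_bounded[of "\<lambda>_. 1" "\<lambda>n. n" q "\<lambda>n. n * (n + 1) div 2" r, OF _ _ assms superlinear_triangular]
  by (simp add: psi2_def)

text \<open>Shifting by two adds 2n + 3 to the triangular exponent. A shift by one would replace w
  by w q; the double shift gives w q^2, in step with the base q^2 of the Pochhammer symbols.\<close>

lemma psi2_rec:
  assumes "norm q < 1"
  shows "psi2 w q = 1 + w * q + w\<^sup>2 * q ^ 3 * psi2 (w * q\<^sup>2) q"
proof -
  have s: "summable (\<lambda>n. v ^ n * q ^ (n * (n + 1) div 2))" for v
    using psi2_bounded[OF assms, of "norm v"] by auto
  have "w ^ (n + 2) * q ^ ((n + 2) * (n + 2 + 1) div 2) =
      w\<^sup>2 * q ^ 3 * ((w * q\<^sup>2) ^ n * q ^ (n * (n + 1) div 2))" for n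
  proof -
    have t: "(n + 2) * (n + 2 + 1) = n * (n + 1) + 2 * (2 * n + 3)" by (simp add: algebra_simps)
    have e: "(n + 2) * (n + 2 + 1) div 2 = n * (n + 1) div 2 + (2 * n + 3)"
      unfolding t by (subst div_mult_self2) simp_all
    show ?thesis unfolding e by (simp add: power_add power_mult power_mult_distrib power2_eq_square mult_ac)
  qed
  from suminf_shift[OF s s this] show ?thesis
    unfolding psi2_def by (simp add: numeral_2_eq_2)
qed

lemma norm_kronecker_3_le: "norm (of_int (kronecker a 3) :: complex) \<le> 1"
  by (simp add: kronecker_3)

lemma psi5_bounded:
  assumes "norm q < 1"
  shows "\<exists>C. \<forall>w. norm w \<le> r \<longrightarrow>
    summable (\<lambda>n. of_int (kronecker (int n) 3) * (- w) ^ (n - 1) * q ^ ((n\<^sup>2 - 1) div 3)) \<and>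
    norm (psi5 w q) \<le> C"
proof -
  obtain C where C: "\<forall>w. norm w \<le> r \<longrightarrow>
      summable (\<lambda>n. of_int (kronecker (int n) 3) * w ^ (n - 1) * q ^ ((n\<^sup>2 - 1) div 3)) \<and>
      norm (\<Sum>n. of_int (kronecker (int n) 3) * w ^ (n - 1) * q ^ ((n\<^sup>2 - 1) div 3)) \<le> C"
    using lacunary_series_bounded[OF norm_kronecker_3_le diff_le_self assms superlinear_square_div[OF zero_less_numeral]] by meson
  show ?thesis unfolding psi5_def
    using C[THEN spec, of "- w" for w, unfolded norm_minus_cancel] by (intro exI allI)
qed

text \<open>The symbol has period 3, and n -> n + 3 raises (n^2 - 1)/3 by 2n + 3 = 2(n - 1) + 5,
  which turns w into w q^2 and leaves q^5. The sign comes from (-w)^3. For n divisible by 3, where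
  the exponents are truncated, both terms vanish.\<close>

lemma psi5_rec:
  assumes "norm q < 1"
  shows "psi5 w q = 1 + w * q - w ^ 3 * q ^ 5 * psi5 (w * q\<^sup>2) q"
proof -
  define f where "f v n = of_int (kronecker (int n) 3) * (- v) ^ (n - 1) * q ^ ((n\<^sup>2 - 1) div 3)" for v n
  have s: "summable (f v)" for v
    by (rule exE[OF psi5_bounded[OF assms, of "norm v"]]) (simp add: f_def[abs_def])
  have "f w (n + 3) = - (w ^ 3 * q ^ 5) * f (w * q\<^sup>2) n" for n
  proof (cases "n mod 3 = 0")
    case False
    have "int (n + 3) mod 3 = int n mod 3" by simp
    then have k: "kronecker (int (n + 3)) 3 = kronecker (int n) 3" by (simp only: kronecker_3)
    from False obtain l where l: "n = 3 * l + 1 \<or> n = 3 * l + 2"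
      by (metis mult_div_mod_eq mod_less_divisor One_nat_def less_2_cases numeral_3_eq_3 less_Suc_eq numeral_2_eq_2 zero_less_Suc)
    have e: "((n + 3)\<^sup>2 - 1) div 3 = (n\<^sup>2 - 1) div 3 + 2 * (n - 1) + 5"
      using l by (auto simp: power2_eq_square algebra_simps)
    have n3: "n + 3 - 1 = (n - 1) + 3" using l by auto
    have "(- w) ^ (n + 3 - 1) = - (w ^ 3) * (- w) ^ (n - 1)"
      unfolding n3 power_add by (simp add: power3_eq_cube)
    moreover have "(- (w * q\<^sup>2)) ^ (n - 1) = (- w) ^ (n - 1) * q ^ (2 * (n - 1))"
      unfolding mult_minus_left[symmetric] by (simp only: power_mult_distrib power_mult)
    ultimately show ?thesis unfolding f_def k e power_add by (simp only: mult_ac mult_minus_left mult_minus_right)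
  next
    case True
    have "int n mod 3 = 0" using True zmod_int[of n 3] by simp
    moreover from this have "int (n + 3) mod 3 = 0" by simp
    ultimately have "kronecker (int n) 3 = 0" "kronecker (int (n + 3)) 3 = 0"
      by (simp_all only: kronecker_3 if_True refl)
    then show ?thesis by (simp add: f_def)
  qed
  from suminf_shift[OF s s this] show ?thesis
    by (simp add: psi5_def f_def[abs_def] lessThan_nat_numeral kronecker_3 power2_eq_square)
qed

text \<open>The series inside \<open>psi1\<close>. For n = 6k + 1 or n = 6k - 1 the exponent of p is
  the generalised pentagonal number k(3k + 1)/2 or k(3k - 1)/2.\<close>

definition pentagonal_series :: "complex \<Rightarrow> complex \<Rightarrow> complex" where
  "pentagonal_series w p =
     (\<Sum>n. of_int (kronecker 12 (int n)) * w ^ ((n - 1) div 2) * p ^ ((n\<^sup>2 - 1) div 24))"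

lemma norm_kronecker_12_le: "norm (of_int (kronecker 12 (int n)) :: complex) \<le> 1"
  by (simp add: kronecker_12 chi12_def)

lemma pentagonal_series_bounded:
  assumes "norm p < 1"
  shows "\<exists>C. \<forall>w. norm w \<le> r \<longrightarrow>
    summable (\<lambda>n. of_int (kronecker 12 (int n)) * w ^ ((n - 1) div 2) * p ^ ((n\<^sup>2 - 1) div 24)) \<and>
    norm (pentagonal_series w p) \<le> C"
  unfolding pentagonal_series_def
  by (intro lacunary_series_bounded norm_kronecker_12_le assms superlinear_square_div)
    (simp_all add: div_le_dividend order.trans[OF div_le_dividend])

text \<open>The shift n -> n + 6 flips the sign of the character and raises (n^2 - 1)/24 by (n -
  1)/2 + 2, which replaces w by w p. The initial terms left over are those at n = 1 and n =
  5.\<close>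

lemma pentagonal_series_rec:
  assumes "norm p < 1"
  shows "pentagonal_series w p = 1 - w\<^sup>2 * p - w ^ 3 * p\<^sup>2 * pentagonal_series (w * p) p"
proof -
  define f where "f v n = of_int (kronecker 12 (int n)) * v ^ ((n - 1) div 2) * p ^ ((n\<^sup>2 - 1) div 24)" for v n
  have s: "summable (f v)" for v
    by (rule exE[OF pentagonal_series_bounded[OF assms, of "norm v"]]) (simp add: f_def[abs_def])
  have k: "kronecker 12 (int (n + 6)) = - kronecker 12 (int n)" for n
    using chi12_add_6[of "int n"] unfolding kronecker_12 by simp
  have "f w (n + 6) = - (w ^ 3 * p\<^sup>2) * f (w * p) n" for n
  proof (cases "n mod 6 = 1 \<or> n mod 6 = 5")
    case True
    define l where "l = n div 6"
    have "n = 6 * l + n mod 6" unfolding l_def by simp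
    then have l: "n = 6 * l + 1 \<or> n = 6 * l + 5" using True by auto
    have e: "((n + 6)\<^sup>2 - 1) div 24 = (n\<^sup>2 - 1) div 24 + (n - 1) div 2 + 2"
    proof -
      have a: "(n + 6)\<^sup>2 - 1 = (n\<^sup>2 - 1) + 24 * ((n - 1) div 2 + 2)"
        using l by (auto simp: power2_eq_square algebra_simps)
      show ?thesis unfolding a by simp
    qed
    have "(n + 6 - 1) div 2 = (n - 1) div 2 + 3" using l by auto
    then show ?thesis unfolding f_def k e
      by (simp add: power_add power_mult_distrib power2_eq_square mult_ac)
  next
    case False
    have "int n mod 6 = int n mod 12 mod 6" by (simp add: mod_mod_cancel)
    moreover have "int n mod 6 \<noteq> 1" "int n mod 6 \<noteq> 5"
      using False zmod_int[of n 6] by auto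
    ultimately have "kronecker 12 (int n) = 0" unfolding kronecker_12 by (auto simp: chi12_def)
    then show ?thesis by (simp only: f_def k) simp
  qed
  from suminf_shift[OF s s this] show ?thesis
    by (simp add: pentagonal_series_def f_def[abs_def] lessThan_nat_numeral kronecker_12 chi12_def power2_eq_square)
qed

text \<open>The summand - w of \<open>psi1\<close> cancels against the added 1, and the remaining
  factor w against the 1/w in front.\<close>

lemma s1_eq:
  assumes "w \<noteq> 0"
  shows "s1 w q = - (qpoch_inf q (q\<^sup>2) / (qpoch_inf (w * q) (q\<^sup>2) * qpoch_inf (inverse w * q) (q\<^sup>2)) *
    pentagonal_series w (q\<^sup>2))"
proof -
  have "inverse w * psi1 w (q\<^sup>2) + 1 = - (w * pentagonal_series w (q\<^sup>2))"
    using assms by (simp add: psi1_def pentagonal_series_def power2_eq_square field_simps)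
  then show ?thesis using assms by (simp add: s1_def)
qed


section \<open>Summation of the three series\<close>

lemma summable_power_mult_convergent:
  fixes p :: complex
  assumes "norm p < 1" "convergent u"
  shows "summable (\<lambda>m. norm (p ^ m * u m))"
proof -
  obtain K where K: "\<And>m. norm (u m) \<le> K"
    using convergent_imp_Bseq[OF assms(2)] unfolding Bseq_def by auto
  show ?thesis
  proof (rule summable_comparison_test')
    show "summable (\<lambda>m. norm p ^ m * K)"
      using assms(1) by (intro summable_mult2 summable_geometric) auto
    show "norm (norm (p ^ m * u m)) \<le> norm p ^ m * K" for m
      using K by (auto simp: norm_mult norm_power intro!: mult_left_mono)
  qed
qed

lemma norm_le_power_of_ratio:
  fixes T r :: "nat \<Rightarrow> complex"
  assumes "\<And>n. T (Suc n) = r n * T n" "\<And>n. norm (r n) \<le> B"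
  shows "norm (T n) \<le> B ^ n * norm (T 0)"
proof (induction n)
  case (Suc n)
  have "norm (r n) * norm (T n) \<le> B * (B ^ n * norm (T 0))"
    using Suc assms(2)[of n] order_trans[OF norm_ge_zero assms(2)[of n]] by (intro mult_mono) auto
  then show ?case by (simp add: assms(1) norm_mult mult.assoc)
qed simp

lemma theta_weight_tendsto_0:
  assumes "norm q < 1"
  shows "(\<lambda>n. (w * (q\<^sup>2) ^ n)\<^sup>2 * q ^ 3) \<longlonglongrightarrow> (0 :: complex)"
proof -
  have "norm (q\<^sup>2) < 1" using assms by (simp add: norm_power power_less_one_iff)
  then have "(\<lambda>n. (w * (q\<^sup>2) ^ n)\<^sup>2 * q ^ 3) \<longlonglongrightarrow> (w * 0)\<^sup>2 * q ^ 3"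
    by (intro tendsto_intros LIMSEQ_power_zero)
  then show ?thesis by simp
qed

lemma norm_mult_power_le: "norm p < 1 \<Longrightarrow> norm (w * p ^ n) \<le> norm (w :: complex)"
  by (simp add: norm_mult norm_power mult_left_le power_le_one)

text \<open>This product is the multiplier that the infinite-product term acquires after n shifts,
  taken with \<open>q\<close> = 1 in the case of \<open>K\<close>. Geometric growth is what
  \<open>telescoping_recurrence\<close> asks of R.\<close>

lemma norm_prod_scaled_power_le:
  fixes w p q :: complex
  assumes "norm p < 1" "norm q \<le> 1"
  shows "norm (\<Prod>k<n. - (w * p ^ k * q)) \<le> max 1 (norm w) ^ n"
proof -
  have "norm (\<Prod>k<n. - (w * p ^ k * q)) = (\<Prod>k<n. norm (- (w * p ^ k * q)))" by (rule prod_norm[symmetric])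
  also have "\<dots> \<le> (\<Prod>k<n. max 1 (norm w))"
  proof (intro prod_mono conjI)
    fix k
    have "norm (w * p ^ k * q) \<le> norm (w * p ^ k) * 1"
      unfolding norm_mult[of _ q] using assms(2) by (intro mult_left_mono) auto
    then show "norm (- (w * p ^ k * q)) \<le> max 1 (norm w)"
      using norm_mult_power_le[OF assms(1), of w k] by simp
  qed simp
  finally show ?thesis by simp
qed

section \<open>Polynomial identities behind the ratios in m and the telescoping\<close>

lemma ratio_step_K:
  fixes a p q x U U' y1 y2 :: complex
  assumes "(a - p * x) * U' = a * (1 - q * x) * U * y1" "y2 * (1 - a * p * (p * x)) = 1"
  shows "(p * a - p * x) * (U' * (p * x - a) * y2) * (1 - p * a * p * x) =
    p * a * (1 - q * x) * (U * (x - a) * y1)"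
proof -
  have "(p * a - p * x) * (U' * (p * x - a) * y2) * (1 - p * a * p * x) - p * a * (1 - q * x) * (U * (x - a) * y1)
    = - p * (a - x) * (y2 * (1 - a * p * (p * x)) - 1) * ((a - p * x) * U')
      - p * (a - x) * ((a - p * x) * U' - a * (1 - q * x) * U * y1)"
    by (simp add: algebra_simps)
  then show ?thesis by (simp only: assms diff_self mult_zero_left mult_zero_right right_minus_eq)
qed

text \<open>A telescoping certificate with \<open>x\<close> for p^m and G = (1 + a q)(a - x) U. The
  difference of the two sides is a combination of the first two assumptions, the second of which
  eliminates U'.\<close>

lemma telescope_step_K:
  fixes a p q x U U' y :: complex
  assumes "y * (1 - a * p * x) = 1" "(a - p * x) * U' = a * (1 - q * x) * U * y" "p = q\<^sup>2"
  shows "x * U - a\<^sup>2 * q ^ 3 * (x * (U * (x - a) * y)) = (1 + a * q) * (a - p * x) * U' - (1 + a * q) * (a - x) * U"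
proof -
  have "x * U - a\<^sup>2 * q ^ 3 * (x * (U * (x - a) * y)) - ((1 + a * q) * (a - p * x) * U' - (1 + a * q) * (a - x) * U)
    = U * (x + (1 + a * q) * (a - x)) * (1 - y * (1 - a * p * x)) +
      (1 + a * q) * (a * (1 - q * x) * U * y - (a - p * x) * U')"
    unfolding assms(3) by (simp add: algebra_simps eval_nat_numeral)
  then show ?thesis by (simp only: assms(1,2) diff_self mult_zero_right right_minus_eq add_0)
qed

lemma ratio_step_K1:
  fixes a p q x U U' y1 y2 :: complex
  assumes "(a - q * p * x) * U' = a * (1 - q * x) * U * y1" "y2 * (1 - a * q * p * (p * x)) = 1" "p = q\<^sup>2"
  shows "(p * a - q * p * x) * (U' * - (a * q - p * (p * x)) * y2) * (1 - p * a * q * p * x) =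
    p * a * (1 - q * x) * (U * - (a * q - p * x) * y1)"
proof -
  have "(p * a - q * p * x) * (U' * - (a * q - p * (p * x)) * y2) * (1 - p * a * q * p * x) -
      p * a * (1 - q * x) * (U * - (a * q - p * x) * y1)
    = - p * q * (a - q * x) * (y2 * (1 - a * q * p * (p * x)) - 1) * ((a - q * p * x) * U')
      - p * q * (a - q * x) * ((a - q * p * x) * U' - a * (1 - q * x) * U * y1)"
    unfolding assms(3) by (simp add: algebra_simps eval_nat_numeral)
  then show ?thesis by (simp only: assms(1,2) diff_self mult_zero_left mult_zero_right right_minus_eq)
qed

text \<open>Everything is multiplied by \<open>a\<close>, which clears the 1/a in T and G. The
  shifted term appears with a plus sign because its factor - (a q - p x) has been rewritten as - q
  (a - q x).\<close>

lemma telescope_step_K1: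
  fixes a p q x U U' y :: complex
  assumes "y * (1 - a * q * p * x) = 1" "(a - q * p * x) * U' = a * (1 - q * x) * U * y" "p = q\<^sup>2"
  shows "(a - 1) * q * x * U + a\<^sup>2 * q ^ 3 * (p * a - 1) * x * (U * (a - q * x) * y) =
     - (1 - a\<^sup>2 * q\<^sup>2) * (a - q * p * x) * U' - - (1 - a\<^sup>2 * q\<^sup>2) * (a - q * x) * U"
proof -
  have "(a - 1) * q * x * U + a\<^sup>2 * q ^ 3 * (p * a - 1) * x * (U * (a - q * x) * y) -
     (- (1 - a\<^sup>2 * q\<^sup>2) * (a - q * p * x) * U' - - (1 - a\<^sup>2 * q\<^sup>2) * (a - q * x) * U) =
     ((a - 1) * q * x - (1 - a\<^sup>2 * q\<^sup>2) * (a - q * x)) * U * (1 - y * (1 - a * q * p * x)) +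
     (1 - a\<^sup>2 * q\<^sup>2) * ((a - q * p * x) * U' - a * (1 - q * x) * U * y)"
    unfolding assms(3) by (simp add: algebra_simps eval_nat_numeral)
  then show ?thesis by (simp only: assms(1,2) diff_self mult_zero_right right_minus_eq add_0)
qed

text \<open>Here \<open>v\<close> stands for U n m, through which U n (m + 1) and U (n + 1) m are
  already expressed. The difference of the sides is then a combination of the equations for the
  inverses \<open>y\<close> and \<open>z\<close>.\<close>

lemma telescope_step_kappa:
  fixes a p q x v y z :: complex
  assumes "y * (1 - a * q * p * x) = 1" "p = q\<^sup>2" "z * (1 - p * a) = 1"
  shows "(1 - a) * v - a\<^sup>2 * q ^ 3 * ((1 - p * a) * (v * (x * (1 - a * p * x) * (1 - a * q) * (y * z)))) =
     - (1 - a\<^sup>2 * q\<^sup>2 * (p * x)) * (a * (1 - a * p * x) * v * y) - - (1 - a\<^sup>2 * q\<^sup>2 * x) * v"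
proof -
  have "(1 - a) * v - a\<^sup>2 * q ^ 3 * ((1 - p * a) * (v * (x * (1 - a * p * x) * (1 - a * q) * (y * z)))) -
     (- (1 - a\<^sup>2 * q\<^sup>2 * (p * x)) * (a * (1 - a * p * x) * v * y) - - (1 - a\<^sup>2 * q\<^sup>2 * x) * v) =
     - v * ((1 - a\<^sup>2 * q\<^sup>2 * x) - (1 - a)) * (1 - y * (1 - a * q * p * x)) 
     - a\<^sup>2 * q ^ 3 * v * x * (1 - a * p * x) * (1 - a * q) * y * (z * (1 - p * a) - 1)"
    unfolding assms(2) by (simp add: algebra_simps eval_nat_numeral)
  then show ?thesis by (simp only: assms(1,3) diff_self mult_zero_right right_minus_eq)
qed

section \<open>The three sums in base q^2\<close>

lemma K_series_sums:
  fixes q w :: complex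
  assumes q: "norm q < 1" and w0: "w \<noteq> 0"
    and nw: "\<And>j. w * q\<^sup>2 * (q\<^sup>2) ^ j \<noteq> 1" and nv: "\<And>j. inverse w * q\<^sup>2 * (q\<^sup>2) ^ j \<noteq> 1"
  shows "(\<lambda>m. (q\<^sup>2) ^ m * (qpoch q (q\<^sup>2) m /
      (qpoch (w * q\<^sup>2) (q\<^sup>2) m * qpoch (inverse w * q\<^sup>2) (q\<^sup>2) m)))
    sums ((1 - w) * psi2 w q + S5 w q)"
proof -
  define p where "p = q\<^sup>2"
  have p: "norm p < 1" using q by (simp add: p_def norm_power power_less_one_iff)
  note nw = nw[folded p_def] and nv = nv[folded p_def]
  define a where "a n = w * p ^ n" for n
  define u where "u m = qpoch q p m / (qpoch (w * p) p m * qpoch (inverse w * p) p m)" for m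
  \<comment> \<open>\<open>U n m\<close> equals \<open>(1 - w) / (1 - a n)\<close> times \<open>qpoch q p m / (qpoch (a n * p) p m * qpoch (p / a n) p m)\<close>,
    but that closed form would divide by zero at \<open>w = 1\<close>, which is not excluded.\<close>
  define U where "U n m = u m * (\<Prod>k<n. (p ^ m - a k) / (1 - a k * p * p ^ m))" for n m
  define Q where "Q = qpoch_inf q p / (qpoch_inf (w * p) p * qpoch_inf (inverse w * p) p)"
  define T where "T n m = p ^ m * U n m" for n m
  define G where "G n m = (1 + a n * q) * (a n - p ^ m) * U n m" for n m
  define L where "L n = (1 + a n * q) * (a n - 0) * (Q * (\<Prod>k<n. (0 - a k) / (1 - a k * p * 0)))" for n
  \<comment> \<open>For w different from 1 this is the right side at \<open>a n\<close> times (1 -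
    w)/(1 - a n), matching the normalisation of \<open>U\<close>; the product of the - a k is the
    quasi-periodicity factor of the infinite products in \<open>S5\<close>. The factor 1 fits it to
    \<open>norm_prod_scaled_power_le\<close>.\<close>
  define R where "R n = (1 - w) * psi2 (a n) q + Q * a n * (\<Prod>k<n. - (a k * 1)) * psi5 (a n) q" for n
  have nz: "1 - a k * p * p ^ m \<noteq> 0" for k m
    using nw[of "k + m"] by (simp add: a_def power_add mult_ac)
  have a_Suc: "a (Suc n) = p * a n" for n by (simp add: a_def)
  have U_Suc: "U (Suc n) m = U n m * (p ^ m - a n) / (1 - a n * p * p ^ m)" for n m
    by (simp add: U_def)
  \<comment> \<open>Kept free of division by a n - p^(m+1), which vanishes for w = 1 and n = m +
    1.\<close>
  have ratio: "(a n - p * p ^ m) * U n (Suc m) =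
      a n * (1 - q * p ^ m) * U n m * inverse (1 - a n * p * p ^ m)" for n m
  proof (induction n)
    case 0
    have "1 - w * p * p ^ m \<noteq> 0" "1 - inverse w * p * p ^ m \<noteq> 0" using nw[of m] nv[of m] by auto
    moreover have "w - p * p ^ m = w * (1 - inverse w * p * p ^ m)" using w0 by (simp add: field_simps)
    ultimately show ?case by (simp add: U_def u_def a_def qpoch_Suc divide_inverse)
  next
    case (Suc n)
    define y1 where "y1 = inverse (1 - a n * p * p ^ m)"
    define y2 where "y2 = inverse (1 - a n * p * (p * p ^ m))"
    have y2: "y2 * (1 - a n * p * (p * p ^ m)) = 1" using nz[of n "Suc m"] by (simp add: y2_def)
    have e: "U (Suc n) m = U n m * (p ^ m - a n) * y1" "U (Suc n) (Suc m) = U n (Suc m) * (p * p ^ m - a n) * y2"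
      by (simp_all add: U_Suc y1_def y2_def divide_inverse)
    have "1 - p * a n * p * p ^ m \<noteq> 0" using nz[of "Suc n" m] by (simp add: a_Suc)
    then show ?case unfolding e a_Suc
      using ratio_step_K[OF Suc[folded y1_def] y2] by (simp add: divide_inverse[symmetric] eq_divide_eq)
  qed
  have "T 0 sums R 0"
  proof -
    obtain d where d: "0 < d" "\<And>j. d \<le> norm (1 - (w * p) * p ^ j)"
      using geometric_away_from_1[OF p nw] by blast
    obtain C2 where C2: "\<And>v. norm v \<le> norm w \<Longrightarrow> norm (psi2 v q) \<le> C2" using psi2_bounded[OF q] by blast
    obtain C5 where C5: "\<And>v. norm v \<le> norm w \<Longrightarrow> norm (psi5 v q) \<le> C5" using psi5_bounded[OF q] by blast
    have an: "norm (a n) \<le> norm w" for n unfolding a_def by (rule norm_mult_power_le[OF p])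
    have u: "u \<longlonglongrightarrow> Q" unfolding u_def Q_def
      by (intro tendsto_intros qpoch_LIMSEQ p) (simp add: qpoch_inf_nonzero[OF p] nw nv)
    show ?thesis
    proof (rule telescoping_recurrence[where W = "\<lambda>n. (a n)\<^sup>2 * q ^ 3" and G = G and L = L
          and M = "\<lambda>m. norm (T 0 m)" and B = "(1 + norm w) / d" and A = "max 1 (norm w)"
          and C = "norm (1 - w) * C2 + norm Q * norm w * C5"])
      show "0 < (1 + norm w) / d" using d by (intro divide_pos_pos) (auto intro: add_pos_nonneg)
      show "(\<lambda>n. (a n)\<^sup>2 * q ^ 3) \<longlonglongrightarrow> 0"
        unfolding a_def p_def by (rule theta_weight_tendsto_0[OF q])
      show "summable (\<lambda>m. norm (T 0 m))"
        unfolding T_def U_def using summable_power_mult_convergent[OF p convergentI[OF u]] by simp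
      show "norm (T n m) \<le> ((1 + norm w) / d) ^ n * norm (T 0 m)" for n m
      proof (rule norm_le_power_of_ratio)
        show "T (Suc n) m = (p ^ m - a n) / (1 - a n * p * p ^ m) * T n m" for n
          by (simp add: T_def U_Suc)
        fix n
        have "norm (p ^ m - a n) \<le> 1 + norm w"
          using norm_triangle_ineq4[of "p ^ m" "a n"] an[of n] p
          by (smt (verit) norm_power power_le_one norm_ge_zero)
        moreover have "d \<le> norm (1 - a n * p * p ^ m)"
          using d(2)[of "n + m"] by (simp add: a_def power_add mult_ac)
        ultimately show "norm ((p ^ m - a n) / (1 - a n * p * p ^ m)) \<le> (1 + norm w) / d"
          unfolding norm_divide using d by (intro frac_le) auto
      qed
      show "T n m - (a n)\<^sup>2 * q ^ 3 * T (Suc n) m = G n (Suc m) - G n m" for n m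
      proof -
        define y where "y = inverse (1 - a n * p * p ^ m)"
        have y: "y * (1 - a n * p * p ^ m) = 1" using nz[of n m] by (simp add: y_def)
        have e: "U (Suc n) m = U n m * (p ^ m - a n) * y" by (simp add: U_Suc y_def divide_inverse)
        show ?thesis unfolding T_def G_def e power_Suc
          using telescope_step_K[OF y ratio[of n m, folded y_def] p_def] .
      qed
      show "G n \<longlonglongrightarrow> L n" for n
        unfolding G_def L_def U_def using p by (intro tendsto_intros LIMSEQ_power_zero u) auto
      \<comment> \<open>At m = 0 the product telescopes, its k-th factor being (1 - a k)/(1 - a (k +
        1)). The form multiplied by 1 - a n also covers a n = 1.\<close>
      have U0: "(1 - a n) * U n 0 = 1 - w" for n
      proof (induction n)
        case (Suc n)
        then show ?case using nz[of n 0] by (simp add: U_Suc a_Suc mult_ac)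
      qed (simp add: U_def u_def a_def)
      show "R n = L n - G n 0 + (a n)\<^sup>2 * q ^ 3 * R (Suc n)" for n
      proof -
        have G0: "G n 0 = - (1 + a n * q) * (1 - w)"
          unfolding G_def U0[of n, symmetric] by (simp add: algebra_simps)
        define P where "P = (\<Prod>k<n. - (a k * 1))"
        have L: "L n = (1 + a n * q) * a n * (Q * P)" by (simp add: L_def P_def)
        have e2: "psi2 (a n) q = 1 + a n * q + (a n)\<^sup>2 * q ^ 3 * psi2 (a (Suc n)) q"
          using psi2_rec[OF q, of "a n"] by (simp add: a_Suc p_def mult_ac)
        have e5: "psi5 (a n) q = 1 + a n * q - (a n) ^ 3 * q ^ 5 * psi5 (a (Suc n)) q"
          using psi5_rec[OF q, of "a n"] by (simp add: a_Suc p_def mult_ac)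
        have RS: "R (Suc n) = (1 - w) * psi2 (a (Suc n)) q - Q * (q\<^sup>2 * a n) * P * a n * psi5 (a (Suc n)) q"
          by (simp add: R_def P_def a_Suc p_def mult_ac)
        have RR: "R n = (1 - w) * psi2 (a n) q + Q * a n * P * psi5 (a n) q"
          by (simp add: R_def P_def)
        \<comment> \<open>\<open>- G n 0\<close> supplies the initial terms of
          \<open>psi2_rec\<close>, and \<open>L n\<close> those of \<open>psi5_rec\<close>.\<close>
        show ?thesis unfolding RS RR L G0 e2 e5 by (simp add: algebra_simps eval_nat_numeral)
      qed
      show "norm (R n) \<le> (norm (1 - w) * C2 + norm Q * norm w * C5) * max 1 (norm w) ^ n" for n
      proof -
        have "norm ((1 - w) * psi2 (a n) q) \<le> norm (1 - w) * C2 * 1"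
          unfolding norm_mult using C2[OF an] by (simp add: mult_left_mono)
        also have "\<dots> \<le> norm (1 - w) * C2 * max 1 (norm w) ^ n"
          using order_trans[OF norm_ge_zero C2[OF an]] by (intro mult_left_mono one_le_power) auto
        finally have 1: "norm ((1 - w) * psi2 (a n) q) \<le> norm (1 - w) * C2 * max 1 (norm w) ^ n" .
        have "norm (\<Prod>k<n. - (a k * 1)) \<le> max 1 (norm w) ^ n"
          unfolding a_def by (rule norm_prod_scaled_power_le[OF p]) simp
        then have 2: "norm (Q * a n * (\<Prod>k<n. - (a k * 1)) * psi5 (a n) q) \<le>
            norm Q * norm w * max 1 (norm w) ^ n * C5"
          unfolding norm_mult using C5[OF an] an by (intro mult_mono) auto
        show ?thesis
          using norm_triangle_le[OF add_mono[OF 1 2], folded R_def] by (simp add: distrib_right distrib_left mult_ac)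
      qed
    qed (simp add: less_max_iff_disj)
  qed
  moreover have "R 0 = (1 - w) * psi2 w q + S5 w q"
    by (simp add: R_def a_def Q_def S5_def p_def mult_ac)
  moreover have "T 0 = (\<lambda>m. p ^ m * u m)" by (simp add: T_def U_def fun_eq_iff)
  ultimately show ?thesis by (simp add: u_def p_def)
qed

lemma K1_series_sums:
  fixes q w :: complex
  assumes q0: "q \<noteq> 0" and q: "norm q < 1" and w0: "w \<noteq> 0"
    and nw: "\<And>j. w * q * (q\<^sup>2) ^ j \<noteq> 1" and nv: "\<And>j. inverse w * q * (q\<^sup>2) ^ j \<noteq> 1"
  shows "(\<lambda>m. (1 - inverse w) * (q * (q\<^sup>2) ^ m * (qpoch q (q\<^sup>2) m /
      (qpoch (w * q) (q\<^sup>2) (Suc m) * qpoch (inverse w * q) (q\<^sup>2) (Suc m)))))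
    sums (psi2 w q + s1 w q)"
proof -
  define p where "p = q\<^sup>2"
  have p: "norm p < 1" using q by (simp add: p_def norm_power power_less_one_iff)
  have p0: "p \<noteq> 0" using q0 by (simp add: p_def)
  note nw = nw[folded p_def] and nv = nv[folded p_def]
  define a where "a n = w * p ^ n" for n
  define u where "u m = qpoch q p m / (qpoch (w * q) p (Suc m) * qpoch (inverse w * q) p (Suc m))" for m
  \<comment> \<open>This is \<open>u m\<close> with w replaced by \<open>a n\<close>: each step from
    a k to a (k + 1) changes both denominator symbols by one factor at either end, and q^2 = p
    simplifies the quotient.\<close>
  define U where "U n m = u m * (\<Prod>k<n. - (a k * q - p * p ^ m) / (1 - a k * q * p * p ^ m))" for n m
  define Q where "Q = qpoch_inf q p / (qpoch_inf (w * q) p * qpoch_inf (inverse w * q) p)"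
  define T where "T n m = (1 - inverse (a n)) * (q * p ^ m * U n m)" for n m
  define G where "G n m = - (1 - (a n)\<^sup>2 * q\<^sup>2) * (1 - q * p ^ m * inverse (a n)) * U n m" for n m
  define L where "L n = - (1 - (a n)\<^sup>2 * q\<^sup>2) * (1 - q * 0 * inverse (a n)) *
    (Q * (\<Prod>k<n. - (a k * q - p * 0) / (1 - a k * q * p * 0)))" for n
  define R where "R n = psi2 (a n) q - Q * (\<Prod>k<n. - (a k * q)) * pentagonal_series (a n) p" for n
  have a0: "a n \<noteq> 0" for n using w0 p0 by (simp add: a_def)
  have nz: "1 - a k * q * p * p ^ m \<noteq> 0" for k m
    using nw[of "Suc (k + m)"] by (simp add: a_def power_add mult_ac)
  have a_Suc: "a (Suc n) = p * a n" for n by (simp add: a_def)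
  have U_Suc: "U (Suc n) m = U n m * - (a n * q - p * p ^ m) * inverse (1 - a n * q * p * p ^ m)" for n m
    by (simp add: U_def divide_inverse)
  have ratio: "(a n - q * p * p ^ m) * U n (Suc m) =
      a n * (1 - q * p ^ m) * U n m * inverse (1 - a n * q * p * p ^ m)" for n m
  proof (induction n)
    case 0
    have "1 - w * q * p ^ Suc m \<noteq> 0" "1 - inverse w * q * p ^ Suc m \<noteq> 0" using nw[of "Suc m"] nv[of "Suc m"] by auto
    moreover have "w - q * p * p ^ m = w * (1 - inverse w * q * p ^ Suc m)" using w0 by (simp add: field_simps)
    ultimately show ?case
      by (simp add: U_def u_def a_def qpoch_Suc[of _ _ m] qpoch_Suc[of _ _ "Suc m"] divide_inverse mult_ac)
  next
    case (Suc n)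
    define y1 where "y1 = inverse (1 - a n * q * p * p ^ m)"
    define y2 where "y2 = inverse (1 - a n * q * p * (p * p ^ m))"
    have y2: "y2 * (1 - a n * q * p * (p * p ^ m)) = 1" using nz[of n "Suc m"] by (simp add: y2_def)
    have e: "U (Suc n) m = U n m * - (a n * q - p * p ^ m) * y1"
      "U (Suc n) (Suc m) = U n (Suc m) * - (a n * q - p * (p * p ^ m)) * y2"
      by (simp_all add: U_Suc y1_def y2_def)
    have "1 - p * a n * q * p * p ^ m \<noteq> 0" using nz[of "Suc n" m] by (simp add: a_Suc)
    then show ?case unfolding e a_Suc
      using ratio_step_K1[OF Suc[folded y1_def] y2 p_def] by (simp add: divide_inverse[symmetric] eq_divide_eq)
  qed
  have "T 0 sums R 0"
  proof -
    obtain d where d: "0 < d" "\<And>j. d \<le> norm (1 - (w * q) * p ^ j)"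
      using geometric_away_from_1[OF p nw] by blast
    obtain C2 where C2: "\<And>v. norm v \<le> norm w \<Longrightarrow> norm (psi2 v q) \<le> C2" using psi2_bounded[OF q] by blast
    obtain C1 where C1: "\<And>v. norm v \<le> norm w \<Longrightarrow> norm (pentagonal_series v p) \<le> C1"
      using pentagonal_series_bounded[OF p] by blast
    have an: "norm (a n) \<le> norm w" for n unfolding a_def by (rule norm_mult_power_le[OF p])
    have u: "u \<longlonglongrightarrow> Q" unfolding u_def Q_def
      by (intro tendsto_intros qpoch_LIMSEQ LIMSEQ_Suc p) (simp add: qpoch_inf_nonzero[OF p] nw nv)
    show ?thesis
    proof (rule telescoping_recurrence[where W = "\<lambda>n. (a n)\<^sup>2 * q ^ 3" and G = G and L = L
          and M = "\<lambda>m. (1 + inverse (norm w)) * norm (q * p ^ m * U 0 m)" and B = "(1 + norm w) / d * inverse (norm p)"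
          and A = "max 1 (norm w)" and C = "C2 + norm Q * C1"])
      show "0 < (1 + norm w) / d * inverse (norm p)"
        using d p0 by (intro mult_pos_pos divide_pos_pos) (auto intro: add_pos_nonneg)
      show "(\<lambda>n. (a n)\<^sup>2 * q ^ 3) \<longlonglongrightarrow> 0"
        unfolding a_def p_def by (rule theta_weight_tendsto_0[OF q])
      have "summable (\<lambda>m. norm q * norm (p ^ m * u m))"
        by (intro summable_mult summable_power_mult_convergent p convergentI[OF u])
      then show "summable (\<lambda>m. (1 + inverse (norm w)) * norm (q * p ^ m * U 0 m))"
        by (intro summable_mult) (simp add: U_def norm_mult mult.assoc)
      \<comment> \<open>The factor 1 - 1/(a n) may grow like |p|^(-n), hence the additional
        \<open>inverse (norm p)\<close> in the base.\<close>
      show "norm (T n m) \<le> ((1 + norm w) / d * inverse (norm p)) ^ n *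
          ((1 + inverse (norm w)) * norm (q * p ^ m * U 0 m))" for n m
      proof -
        have 1: "norm (q * p ^ m * U n m) \<le> ((1 + norm w) / d) ^ n * norm (q * p ^ m * U 0 m)"
        proof (rule norm_le_power_of_ratio)
          show "q * p ^ m * U (Suc n) m =
              - (a n * q - p * p ^ m) / (1 - a n * q * p * p ^ m) * (q * p ^ m * U n m)" for n
            by (simp add: U_Suc divide_inverse mult_ac)
          fix n
          have "norm (a n * q) \<le> norm w * 1" unfolding norm_mult using an q by (intro mult_mono) auto
          moreover have "norm (p * p ^ m) \<le> 1" using p
            by (metis norm_power power_Suc power_le_one norm_ge_zero less_imp_le)
          ultimately have "norm (- (a n * q - p * p ^ m)) \<le> 1 + norm w"
            using norm_triangle_ineq4[of "a n * q" "p * p ^ m"] by (simp add: norm_minus_commute)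
          moreover have "d \<le> norm (1 - a n * q * p * p ^ m)"
            using d(2)[of "Suc (n + m)"] by (simp add: a_def power_add mult_ac)
          ultimately show "norm (- (a n * q - p * p ^ m) / (1 - a n * q * p * p ^ m)) \<le> (1 + norm w) / d"
            unfolding norm_divide using d by (intro frac_le) auto
        qed
        have "1 \<le> inverse (norm p) ^ n" using p p0 by (intro one_le_power) (simp add: one_le_inverse)
        moreover have "norm (inverse (a n)) = inverse (norm w) * inverse (norm p) ^ n"
          by (simp add: a_def norm_mult norm_power norm_inverse power_inverse)
        ultimately have "norm (1 - inverse (a n)) \<le> inverse (norm p) ^ n * (1 + inverse (norm w))"
          using norm_triangle_ineq4[of 1 "inverse (a n)"] by (simp add: algebra_simps)
        then have "norm (T n m) \<le> (inverse (norm p) ^ n * (1 + inverse (norm w))) *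
            (((1 + norm w) / d) ^ n * norm (q * p ^ m * U 0 m))"
          unfolding T_def norm_mult[of "1 - inverse (a n)"] using 1 by (intro mult_mono) auto
        then show ?thesis by (simp only: power_mult_distrib mult_ac)
      qed
      show "T n m - (a n)\<^sup>2 * q ^ 3 * T (Suc n) m = G n (Suc m) - G n m" for n m
      proof -
        define x where "x = p ^ m"
        define y where "y = inverse (1 - a n * q * p * x)"
        have y: "y * (1 - a n * q * p * x) = 1" using nz[of n m] by (simp add: y_def x_def)
        have f: "1 - inverse (a n) = (a n - 1) / a n" "1 - v * inverse (a n) = (a n - v) / a n" for v
          using a0[of n] by (simp_all add: field_simps)
        have t0: "T n m = ((a n - 1) * q * x * U n m) / a n"
          unfolding T_def f by (simp add: x_def mult_ac)
        have "1 - inverse (p * a n) = (p * a n - 1) / (p * a n)"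
          using a0[of n] p0 by (simp add: field_simps)
        moreover have "a n * q - p * x = q * (a n - q * x)"
          by (simp add: p_def power2_eq_square algebra_simps)
        ultimately have "T (Suc n) m = (p * a n - 1) / (p * a n) * (q * x * (U n m * - (q * (a n - q * x)) * y))"
          unfolding T_def a_Suc U_Suc x_def[symmetric] y_def[symmetric] by simp
        also have "(a n)\<^sup>2 * q ^ 3 * \<dots> = - (((a n)\<^sup>2 * q ^ 3 * (p * a n - 1) * x * (U n m * (a n - q * x) * y)) / a n)"
          using a0[of n] q0 by (simp add: p_def field_simps power2_eq_square)
        finally have t1: "(a n)\<^sup>2 * q ^ 3 * T (Suc n) m =
          - (((a n)\<^sup>2 * q ^ 3 * (p * a n - 1) * x * (U n m * (a n - q * x) * y)) / a n)" .
        have "T n m - (a n)\<^sup>2 * q ^ 3 * T (Suc n) m =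
            ((a n - 1) * q * x * U n m + (a n)\<^sup>2 * q ^ 3 * (p * a n - 1) * x * (U n m * (a n - q * x) * y)) / a n"
          unfolding t0 t1 by (simp add: add_divide_distrib)
        also have "\<dots> = (- (1 - (a n)\<^sup>2 * q\<^sup>2) * (a n - q * p * x) * U n (Suc m) -
            - (1 - (a n)\<^sup>2 * q\<^sup>2) * (a n - q * x) * U n m) / a n"
          by (simp only: telescope_step_K1[OF y ratio[of n m, folded x_def, folded y_def] p_def])
        also have "\<dots> = G n (Suc m) - G n m"
          unfolding G_def f power_Suc x_def[symmetric]
            diff_divide_distrib[of "- (1 - (a n)\<^sup>2 * q\<^sup>2) * (a n - q * p * x) * U n (Suc m)"]
          by (simp add: mult_ac)
        finally show ?thesis .
      qed
      show "G n \<longlonglongrightarrow> L n" for n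
        unfolding G_def L_def U_def using p by (intro tendsto_intros LIMSEQ_power_zero u) auto
      \<comment> \<open>U n 0 = 1/((1 - a q)(1 - q/a)) with denominators cleared; in G n 0 it
        reduces 1 - a^2 q^2 to 1 + a q.\<close>
      have U0: "(1 - a n * q) * (a n - q) * U n 0 = a n" for n
      proof (induction n)
        case 0
        have "1 - w * q \<noteq> 0" "1 - inverse w * q \<noteq> 0" using nw[of 0] nv[of 0] by auto
        moreover have "w - q = w * (1 - inverse w * q)" using w0 by (simp add: algebra_simps)
        ultimately show ?case by (simp add: U_def u_def a_def qpoch_Suc)
      next
        case (Suc n)
        have "(1 - p * a n * q) * (p * a n - q) * U (Suc n) 0 =
            p * ((1 - a n * q) * (a n - q) * U n 0) * ((1 - p * a n * q) * inverse (1 - a n * q * p))"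
          unfolding U_Suc by (simp add: p_def algebra_simps eval_nat_numeral)
        also have "(1 - p * a n * q) * inverse (1 - a n * q * p) = 1"
          using nz[of n 0] by (simp add: mult_ac)
        finally show ?case unfolding a_Suc Suc by simp
      qed
      show "R n = L n - G n 0 + (a n)\<^sup>2 * q ^ 3 * R (Suc n)" for n
      proof -
        have "G n 0 = - (1 + a n * q) * ((1 - a n * q) * (a n - q) * U n 0) / a n"
          using a0[of n] by (simp add: G_def field_simps power2_eq_square)
        then have G0: "G n 0 = - (1 + a n * q)" unfolding U0 using a0[of n] by simp
        define P where "P = (\<Prod>k<n. - (a k * q))"
        have L: "L n = - (1 - (a n)\<^sup>2 * q\<^sup>2) * (Q * P)" by (simp add: L_def P_def)
        have e2: "psi2 (a n) q = 1 + a n * q + (a n)\<^sup>2 * q ^ 3 * psi2 (a (Suc n)) q"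
          using psi2_rec[OF q, of "a n"] by (simp add: a_Suc p_def mult_ac)
        have e1: "pentagonal_series (a n) p = 1 - (a n)\<^sup>2 * p - (a n) ^ 3 * p\<^sup>2 * pentagonal_series (a (Suc n)) p"
          using pentagonal_series_rec[OF p, of "a n"] by (simp add: a_Suc mult_ac)
        have RS: "R (Suc n) = psi2 (a (Suc n)) q + Q * P * a n * q * pentagonal_series (a (Suc n)) p"
          by (simp add: R_def P_def mult_ac)
        have RR: "R n = psi2 (a n) q - Q * P * pentagonal_series (a n) p"
          by (simp add: R_def P_def)
        \<comment> \<open>\<open>- G n 0\<close> supplies the initial terms of
          \<open>psi2_rec\<close>, and \<open>L n\<close> those of
          \<open>pentagonal_series_rec\<close>.\<close>
        show ?thesis unfolding RS RR L G0 e2 e1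
          by (simp add: algebra_simps eval_nat_numeral p_def)
      qed
      show "norm (R n) \<le> (C2 + norm Q * C1) * max 1 (norm w) ^ n" for n
      proof -
        have "norm (psi2 (a n) q) \<le> C2 * 1" using C2[OF an] by simp
        also have "\<dots> \<le> C2 * max 1 (norm w) ^ n"
          using order_trans[OF norm_ge_zero C2[OF an]] by (intro mult_left_mono one_le_power) auto
        finally have 1: "norm (psi2 (a n) q) \<le> C2 * max 1 (norm w) ^ n" .
        have "norm (\<Prod>k<n. - (a k * q)) \<le> max 1 (norm w) ^ n"
          unfolding a_def using q by (intro norm_prod_scaled_power_le[OF p]) simp
        then have 2: "norm (Q * (\<Prod>k<n. - (a k * q)) * pentagonal_series (a n) p) \<le>
            norm Q * max 1 (norm w) ^ n * C1"
          unfolding norm_mult using C1[OF an] by (intro mult_mono) auto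
        show ?thesis
          using norm_triangle_le_diff[OF add_mono[OF 1 2], folded R_def] by (simp add: distrib_right distrib_left mult_ac)
      qed
    qed (simp add: less_max_iff_disj)
  qed
  moreover have "R 0 = psi2 w q + s1 w q"
    using s1_eq[OF w0, of q] by (simp add: R_def a_def Q_def p_def)
  moreover have "T 0 = (\<lambda>m. (1 - inverse w) * (q * p ^ m * u m))" by (simp add: T_def U_def a_def fun_eq_iff)
  ultimately show ?thesis by (simp add: u_def p_def)
qed

text \<open>Since |z| < 1, every factor 1 - z p^i v with |v| <= 1 has norm at least 1 - |z|, and the
  power z^m forces G n to tend to 0. So the limits contribute nothing, no infinite product enters,
  and \<open>psi2\<close> alone remains.\<close>

lemma kappa_series_sums:
  fixes q z :: complex
  assumes q: "norm q < 1" and z: "norm z < 1"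
  shows "(\<lambda>m. (1 - z) * (z ^ m * (qpoch (z * q\<^sup>2) (q\<^sup>2) m / qpoch (z * q) (q\<^sup>2) (Suc m)))) sums psi2 z q"
proof -
  define p where "p = q\<^sup>2"
  have p: "norm p < 1" using q by (simp add: p_def norm_power power_less_one_iff)
  define a where "a n = z * p ^ n" for n
  define u where "u m = qpoch (z * p) p m / qpoch (z * q) p (Suc m)" for m
  \<comment> \<open>The quotient of the summands belonging to a (n + 1) and a n; the power p^m comes
    from the power z^m.\<close>
  define r where "r n m = p ^ m * (1 - a n * p * p ^ m) * (1 - a n * q) *
    (inverse (1 - a n * q * p * p ^ m) * inverse (1 - p * a n))" for n m
  define U where "U n m = z ^ m * u m * (\<Prod>k<n. r k m)" for n m
  define T where "T n m = (1 - a n) * U n m" for n m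
  define G where "G n m = - (1 - (a n)\<^sup>2 * q\<^sup>2 * p ^ m) * U n m" for n m
  define d where "d = 1 - norm z"
  have d: "0 < d" using z by (simp add: d_def)
  have small: "norm (z * p ^ i * v) \<le> norm z" if "norm v \<le> 1" for i v
  proof -
    have "norm (z * p ^ i) * norm v \<le> norm z * 1"
      using that by (intro mult_mono norm_mult_power_le[OF p]) auto
    then show ?thesis by (simp add: norm_mult)
  qed
  have ge: "d \<le> norm (1 - z * p ^ i * v)" and le: "norm (1 - z * p ^ i * v) \<le> 2" and nz: "1 - z * p ^ i * v \<noteq> 0"
    if "norm v \<le> 1" for i v
  proof -
    show "d \<le> norm (1 - z * p ^ i * v)" unfolding d_def
      using small[OF that, of i] norm_triangle_ineq2[of 1 "z * p ^ i * v"] by simp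
    then show "1 - z * p ^ i * v \<noteq> 0" using d by auto
    show "norm (1 - z * p ^ i * v) \<le> 2"
      using small[OF that, of i] z norm_triangle_ineq4[of 1 "z * p ^ i * v"] by simp
  qed
  have q1: "norm q \<le> 1" using q by simp
  have a_Suc: "a (Suc n) = p * a n" for n by (simp add: a_def)
  have form: "a n * p * p ^ m = z * p ^ (Suc (n + m)) * 1" "a n * q * p * p ^ m = z * p ^ (Suc (n + m)) * q"
    "p * a n = z * p ^ Suc n * 1" for n m
    by (simp_all add: a_def power_add mult_ac)
  have U_Suc: "U (Suc n) m = U n m * r n m" for n m by (simp add: U_def)
  have ratio: "U n (Suc m) = a n * (1 - a n * p * p ^ m) * U n m * inverse (1 - a n * q * p * p ^ m)" for n m
  proof (induction n)
    case 0
    show ?case by (simp add: U_def u_def a_def qpoch_Suc[of _ _ m] qpoch_Suc[of _ _ "Suc m"] divide_inverse mult_ac)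
  next
    case (Suc n)
    have "inverse (1 - p * a n * q * p * p ^ m) = inverse (1 - a n * q * p * (p * p ^ m))" by (simp add: mult_ac)
    then show ?case unfolding U_Suc Suc r_def a_Suc power_Suc by (simp add: mult_ac)
  qed
  have "T 0 sums psi2 (a 0) q"
  proof -
    obtain C where C: "\<And>v. norm v \<le> norm z \<Longrightarrow> norm (psi2 v q) \<le> C" using psi2_bounded[OF q] by blast
    have an: "norm (a n) \<le> norm z" for n unfolding a_def by (rule norm_mult_power_le[OF p])
    have "qpoch_inf (z * q) p \<noteq> 0"
    proof (rule qpoch_inf_nonzero[OF p])
      show "z * q * p ^ j \<noteq> 1" for j using nz[OF q1, of j] by (simp add: mult_ac)
    qed
    then have u: "u \<longlonglongrightarrow> qpoch_inf (z * p) p / qpoch_inf (z * q) p" unfolding u_def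
      by (intro tendsto_intros qpoch_LIMSEQ LIMSEQ_Suc p)
    have norm_p: "norm (p ^ m) \<le> 1" for m using p by (simp add: norm_power power_le_one)
    \<comment> \<open>Two numerator factors of norm at most 2 over two denominator factors of norm
      at least \<open>d\<close>.\<close>
    have r: "norm (r n m) \<le> 4 / d\<^sup>2" for n m
    proof -
      have "norm (p ^ m * (1 - a n * p * p ^ m) * (1 - a n * q)) \<le> 1 * 2 * 2"
        unfolding norm_mult form by (intro mult_mono norm_p le q1) (auto simp: a_def intro!: le q1)
      moreover have "d * d \<le> norm ((1 - a n * q * p * p ^ m) * (1 - p * a n))"
        unfolding norm_mult form using d by (intro mult_mono ge q1) auto
      ultimately have "norm (p ^ m * (1 - a n * p * p ^ m) * (1 - a n * q)) /
          norm ((1 - a n * q * p * p ^ m) * (1 - p * a n)) \<le> 4 / (d * d)"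
        using d by (intro frac_le) auto
      then show ?thesis by (simp add: r_def norm_mult norm_inverse divide_inverse power2_eq_square)
    qed
    show ?thesis
    proof (rule telescoping_recurrence[where W = "\<lambda>n. (a n)\<^sup>2 * q ^ 3" and G = G and L = "\<lambda>_. 0" and R = "\<lambda>n. psi2 (a n) q"
          and M = "\<lambda>m. 2 * norm (U 0 m)" and B = "4 / d\<^sup>2" and A = 1 and C = C])
      show "0 < 4 / d\<^sup>2" using d by simp
      show "(\<lambda>n. (a n)\<^sup>2 * q ^ 3) \<longlonglongrightarrow> 0"
        unfolding a_def p_def by (rule theta_weight_tendsto_0[OF q])
      show "summable (\<lambda>m. 2 * norm (U 0 m))"
        using summable_power_mult_convergent[OF z convergentI[OF u]] by (simp add: U_def summable_mult)
      have U_le: "norm (U n m) \<le> (4 / d\<^sup>2) ^ n * norm (U 0 m)" for n m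
        by (rule norm_le_power_of_ratio[of "\<lambda>n. U n m" "\<lambda>n. r n m"]) (simp_all add: U_Suc r)
      show "norm (T n m) \<le> (4 / d\<^sup>2) ^ n * (2 * norm (U 0 m))" for n m
      proof -
        have "norm (1 - a n) * norm (U n m) \<le> 2 * ((4 / d\<^sup>2) ^ n * norm (U 0 m))"
          using le[of 1 n] by (intro mult_mono U_le) (auto simp: a_def)
        then show ?thesis by (simp add: T_def norm_mult mult_ac)
      qed
      show "T n m - (a n)\<^sup>2 * q ^ 3 * T (Suc n) m = G n (Suc m) - G n m" for n m
      proof -
        define x where "x = p ^ m"
        define y where "y = inverse (1 - a n * q * p * x)"
        define c where "c = inverse (1 - p * a n)"
        have y: "y * (1 - a n * q * p * x) = 1"
          using nz[OF q1, of "Suc (n + m)"] unfolding y_def x_def form by simp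
        have c: "c * (1 - p * a n) = 1" using nz[of 1 "Suc n"] unfolding c_def form by simp
        show ?thesis
          unfolding T_def G_def ratio U_Suc r_def a_Suc power_Suc x_def[symmetric] y_def[symmetric] c_def[symmetric]
          by (rule telescope_step_kappa[OF y p_def c])
      qed
      show "G n \<longlonglongrightarrow> 0" for n
      proof -
        have "(\<lambda>m. norm (U 0 m)) \<longlonglongrightarrow> 0"
          using summable_power_mult_convergent[OF z convergentI[OF u]]
          by (intro summable_LIMSEQ_zero) (simp add: U_def)
        then have "(\<lambda>m. (4 / d\<^sup>2) ^ n * norm (U 0 m)) \<longlonglongrightarrow> 0"
          by (rule tendsto_mult_right_zero)
        then have "U n \<longlonglongrightarrow> 0"
          by (rule Lim_null_comparison[rotated]) (rule always_eventually, rule allI, rule U_le)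
        then have "G n \<longlonglongrightarrow> - (1 - (a n)\<^sup>2 * q\<^sup>2 * 0) * 0"
          unfolding G_def using p by (intro tendsto_intros LIMSEQ_power_zero)
        then show ?thesis by simp
      qed
      have U0: "(1 - a n * q) * U n 0 = 1" for n
      proof (induction n)
        case 0
        show ?case using nz[OF q1, of 0] by (simp add: U_def u_def a_def qpoch_Suc)
      next
        case (Suc n)
        have n1: "1 - a n * q * p \<noteq> 0" using nz[OF q1, of "Suc n"] by (simp add: a_def mult_ac)
        have n2: "1 - p * a n \<noteq> 0" unfolding form by (rule nz) simp
        have "(1 - a (Suc n) * q) * U (Suc n) 0 = (1 - a n * q * p) * inverse (1 - a n * q * p) *
            ((1 - p * a n) * inverse (1 - p * a n)) * ((1 - a n * q) * U n 0)"
          unfolding U_Suc r_def a_Suc by (simp add: mult_ac)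
        then show ?case using n1 n2 Suc by simp
      qed
      show "psi2 (a n) q = 0 - G n 0 + (a n)\<^sup>2 * q ^ 3 * psi2 (a (Suc n)) q" for n
      proof -
        have "G n 0 = - (1 + a n * q) * ((1 - a n * q) * U n 0)"
          by (simp add: G_def algebra_simps power2_eq_square)
        then have "G n 0 = - (1 + a n * q)" unfolding U0 by simp
        then show ?thesis using psi2_rec[OF q, of "a n"] by (simp add: a_Suc p_def mult_ac)
      qed
      show "norm (psi2 (a n) q) \<le> C * 1 ^ n" for n using C[OF an] by simp
    qed simp
  qed
  moreover have "T 0 = (\<lambda>m. (1 - z) * (z ^ m * u m))" by (simp add: T_def U_def a_def fun_eq_iff)
  ultimately show ?thesis by (simp add: u_def p_def a_def)
qed


section \<open>Passing from base \<open>1/q\<close> to base \<open>q\<close>\<close>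

lemma qpoch_inverse:
  assumes "a \<noteq> 0" "q \<noteq> 0"
  shows "qpoch (inverse a) ((inverse q)\<^sup>2) n = (- 1) ^ n * q ^ n * qpoch a (q\<^sup>2) n / (a ^ n * q ^ (n * n))"
  using qpoch_inverse_base[OF assms, of n] assms by (simp add: field_simps)

text \<open>Since w q^(-2) is the inverse of q^2/w, the two denominator symbols trade places under
  inversion of the base. The signs and the powers of w cancel, and the powers of q collapse to
  q^(2n).\<close>

lemma K_inverse_base:
  assumes w: "w \<noteq> 0" and q: "q \<noteq> 0"
  shows "K w (inverse q) = (\<Sum>m. (q\<^sup>2) ^ m * (qpoch q (q\<^sup>2) m /
      (qpoch (w * q\<^sup>2) (q\<^sup>2) m * qpoch (inverse w * q\<^sup>2) (q\<^sup>2) m)))"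
  unfolding K_def
proof (intro suminf_cong)
  fix n
  define e s x v A D1 D2 where "e = (- 1 :: complex) ^ n" and "s = q ^ (n * n)" and "x = q ^ n" and "v = w ^ n"
    and "A = qpoch q (q\<^sup>2) n" and "D1 = qpoch (w * q\<^sup>2) (q\<^sup>2) n" and "D2 = qpoch (inverse w * q\<^sup>2) (q\<^sup>2) n"
  note defs = e_def s_def x_def v_def A_def D1_def D2_def
  have nz: "e \<noteq> 0" "s \<noteq> 0" "x \<noteq> 0" "v \<noteq> 0" using w q by (auto simp: defs)
  have ee: "e * e = 1" by (simp add: e_def flip: power_mult_distrib)
  have "qpoch (inverse q) ((inverse q)\<^sup>2) n = e * x * A / (x * s)"
    using qpoch_inverse[OF q q, of n] by (simp add: defs)
  moreover have "qpoch (w * (inverse q)\<^sup>2) ((inverse q)\<^sup>2) n = e * x * D2 / (x * x / v * s)"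
  proof -
    have "w * (inverse q)\<^sup>2 = inverse (inverse w * q\<^sup>2)" by (simp add: power_inverse)
    moreover have "(inverse w * q\<^sup>2) ^ n = x * x / v"
      by (simp add: defs power_mult_distrib power2_eq_square power_inverse divide_inverse)
    ultimately show ?thesis
      using qpoch_inverse[of "inverse w * q\<^sup>2" q n] w q by (simp add: defs)
  qed
  moreover have "qpoch (inverse w * (inverse q)\<^sup>2) ((inverse q)\<^sup>2) n = e * x * D1 / (v * x * x * s)"
  proof -
    have "inverse w * (inverse q)\<^sup>2 = inverse (w * q\<^sup>2)" by (simp add: power_inverse)
    moreover have "(w * q\<^sup>2) ^ n = v * x * x"
      by (simp add: defs power_mult_distrib power2_eq_square)
    ultimately show ?thesis
      using qpoch_inverse[of "w * q\<^sup>2" q n] w q by (simp add: defs)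
  qed
  moreover have "inverse q ^ n\<^sup>2 = inverse s" by (simp add: s_def power2_eq_square power_inverse)
  \<comment> \<open>If \<open>D1\<close> or \<open>D2\<close> vanishes, both sides are 0 by the
    convention for division, so the termwise identity holds for every nonzero w.\<close>
  moreover have "e * inverse s * (e * x * A / (x * s)) / (e * x * D2 / (x * x / v * s) * (e * x * D1 / (v * x * x * s)))
    = (x * x) * (A / (D1 * D2))"
    using nz ee by (cases "D1 = 0"; cases "D2 = 0") (simp_all add: field_simps)
  moreover have "(q\<^sup>2) ^ n = x * x" by (simp add: x_def power_mult_distrib power2_eq_square)
  ultimately show "(- 1) ^ n * inverse q ^ n\<^sup>2 * qpoch (inverse q) ((inverse q)\<^sup>2) n /
        (qpoch (w * (inverse q)\<^sup>2) ((inverse q)\<^sup>2) n * qpoch (inverse w * (inverse q)\<^sup>2) ((inverse q)\<^sup>2) n) =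
      (q\<^sup>2) ^ n * (qpoch q (q\<^sup>2) n / (qpoch (w * q\<^sup>2) (q\<^sup>2) n * qpoch (inverse w * q\<^sup>2) (q\<^sup>2) n))"
    unfolding e_def[symmetric] A_def[symmetric] D1_def[symmetric] D2_def[symmetric] by simp
qed

lemma K1_inverse_base:
  assumes w: "w \<noteq> 0" and q: "q \<noteq> 0"
  shows "K1 w (inverse q) = (\<Sum>m. q * (q\<^sup>2) ^ m * (qpoch q (q\<^sup>2) m /
      (qpoch (w * q) (q\<^sup>2) (Suc m) * qpoch (inverse w * q) (q\<^sup>2) (Suc m))))"
  unfolding K1_def
proof (intro suminf_cong)
  fix n
  define e s x v A D1 D2 where "e = (- 1 :: complex) ^ n" and "s = q ^ (n * n)" and "x = q ^ n" and "v = w ^ Suc n"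
    and "A = qpoch q (q\<^sup>2) n" and "D1 = qpoch (w * q) (q\<^sup>2) (Suc n)" and "D2 = qpoch (inverse w * q) (q\<^sup>2) (Suc n)"
  note defs = e_def s_def x_def v_def A_def D1_def D2_def
  have nz: "e \<noteq> 0" "s \<noteq> 0" "x \<noteq> 0" "v \<noteq> 0" using w q by (auto simp: defs)
  have ee: "e * e = 1" by (simp add: e_def flip: power_mult_distrib)
  have s: "q ^ (Suc n * Suc n) = s * x * x * q" by (simp add: defs power_add mult_ac)
  have "qpoch (inverse q) ((inverse q)\<^sup>2) n = e * x * A / (x * s)"
    using qpoch_inverse[OF q q, of n] by (simp add: defs)
  moreover have "qpoch (w * inverse q) ((inverse q)\<^sup>2) (Suc n) = - e * (q * x) * D2 / (q * x / v * (s * x * x * q))"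
  proof -
    have "w * inverse q = inverse (inverse w * q)" by simp
    moreover have "(inverse w * q) ^ Suc n = q * x / v"
      unfolding power_mult_distrib by (simp add: defs power_inverse divide_inverse)
    ultimately show ?thesis
      using qpoch_inverse[of "inverse w * q" q "Suc n"] w q unfolding s by (simp add: e_def x_def D2_def)
  qed
  moreover have "qpoch (inverse w * inverse q) ((inverse q)\<^sup>2) (Suc n) = - e * (q * x) * D1 / (v * (q * x) * (s * x * x * q))"
  proof -
    have "inverse w * inverse q = inverse (w * q)" by simp
    moreover have "(w * q) ^ Suc n = v * (q * x)"
      unfolding power_mult_distrib by (simp add: defs)
    ultimately show ?thesis
      using qpoch_inverse[of "w * q" q "Suc n"] w q unfolding s by (simp add: e_def x_def D1_def)
  qed
  moreover have "inverse q ^ (Suc n)\<^sup>2 = inverse (s * x * x * q)"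
    unfolding power2_eq_square power_inverse s ..
  moreover have "e * inverse (s * x * x * q) * (e * x * A / (x * s)) /
      (- e * (q * x) * D2 / (q * x / v * (s * x * x * q)) * (- e * (q * x) * D1 / (v * (q * x) * (s * x * x * q))))
    = q * (x * x) * (A / (D1 * D2))"
    using nz ee q by (cases "D1 = 0"; cases "D2 = 0") (simp_all add: field_simps)
  moreover have "(q\<^sup>2) ^ n = x * x" by (simp add: x_def power_mult_distrib power2_eq_square)
  ultimately show "(- 1) ^ n * inverse q ^ (Suc n)\<^sup>2 * qpoch (inverse q) ((inverse q)\<^sup>2) n /
        (qpoch (w * inverse q) ((inverse q)\<^sup>2) (Suc n) * qpoch (inverse w * inverse q) ((inverse q)\<^sup>2) (Suc n)) =
      q * (q\<^sup>2) ^ n * (qpoch q (q\<^sup>2) n / (qpoch (w * q) (q\<^sup>2) (Suc n) * qpoch (inverse w * q) (q\<^sup>2) (Suc n)))"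
    unfolding e_def[symmetric] A_def[symmetric] D1_def[symmetric] D2_def[symmetric] by simp
qed

text \<open>The symbols in numerator and denominator have lengths n and n + 1, so one sign and one
  factor 1/w survive as the prefactor.\<close>

lemma kappa_inverse_base:
  assumes w: "w \<noteq> 0" and q: "q \<noteq> 0"
  shows "kappa w (inverse q) = (\<Sum>m. - inverse w * (inverse w ^ m *
    (qpoch (inverse w * q\<^sup>2) (q\<^sup>2) m / qpoch (inverse w * q) (q\<^sup>2) (Suc m))))"
  unfolding kappa_def
proof (intro suminf_cong)
  fix n
  define e s x z v A D where "e = (- 1 :: complex) ^ n" and "s = q ^ (n * n)" and "x = q ^ n" and "z = inverse w" and "v = z ^ n"
    and "A = qpoch (z * q\<^sup>2) (q\<^sup>2) n" and "D = qpoch (z * q) (q\<^sup>2) (Suc n)"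
  note defs = e_def s_def x_def v_def A_def D_def
  have z: "z \<noteq> 0" using w by (simp add: z_def)
  have nz: "e \<noteq> 0" "s \<noteq> 0" "x \<noteq> 0" "v \<noteq> 0" using z q by (auto simp: defs)
  have s: "q ^ (Suc n * Suc n) = s * x * x * q" by (simp add: defs power_add mult_ac)
  have "qpoch (w * (inverse q)\<^sup>2) ((inverse q)\<^sup>2) n = e * x * A / (v * x * x * s)"
  proof -
    have "w * (inverse q)\<^sup>2 = inverse (z * q\<^sup>2)" by (simp add: power_inverse z_def)
    moreover have "(z * q\<^sup>2) ^ n = v * x * x"
      by (simp add: defs power_mult_distrib power2_eq_square)
    ultimately show ?thesis
      using qpoch_inverse[of "z * q\<^sup>2" q n] z q by (simp add: defs)
  qed
  moreover have "qpoch (w * inverse q) ((inverse q)\<^sup>2) (n + 1) = - e * (q * x) * D / (z * v * (q * x) * (s * x * x * q))"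
  proof -
    have "w * inverse q = inverse (z * q)" by (simp add: z_def)
    moreover have "(z * q) ^ Suc n = z * v * (q * x)"
      unfolding power_mult_distrib by (simp add: defs)
    ultimately show ?thesis
      using qpoch_inverse[of "z * q" q "Suc n"] z q unfolding s by (simp add: e_def x_def D_def)
  qed
  moreover have "inverse q ^ (n + 1) = inverse (q * x)" by (simp add: power_inverse x_def)
  moreover have "inverse (q * x) * v * (e * x * A / (v * x * x * s)) /
      (- e * (q * x) * D / (z * v * (q * x) * (s * x * x * q))) = - z * (v * (A / D))"
    using nz q z by (cases "D = 0") (simp_all add: field_simps)
  ultimately show "inverse q ^ (n + 1) * inverse w ^ n * qpoch (w * (inverse q)\<^sup>2) ((inverse q)\<^sup>2) n /
         qpoch (w * inverse q) ((inverse q)\<^sup>2) (n + 1) =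
     - inverse w * (inverse w ^ n * (qpoch (inverse w * q\<^sup>2) (q\<^sup>2) n / qpoch (inverse w * q) (q\<^sup>2) (Suc n)))"
    unfolding z_def[symmetric] v_def[symmetric] A_def[symmetric] D_def[symmetric] by (simp only:)
qed

section \<open>Assembly: normalising factors and excluded values of w\<close>

theorem theorem5p2:
  fixes q :: complex
  assumes "0 < norm q" and "norm q < 1"
  shows "(\<forall>w::complex. norm w > 1 \<and> (\<forall>l::nat. w \<noteq> q ^ (2 * l + 1)) \<longrightarrow>
            kappa w (inverse q) = 1 / (1 - w) * psi2 (inverse w) q) \<and>
         (\<forall>w::complex. w \<noteq> 0 \<and> w \<noteq> 1 \<and> (\<forall>l::int. w \<noteq> q powi (2 * l + 1)) \<longrightarrow>
            K1 w (inverse q) = w / (w - 1) * (psi2 w q + s1 w q)) \<and>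
         (\<forall>w::complex. w \<noteq> 0 \<and> (\<forall>l::int. l \<noteq> 0 \<longrightarrow> w \<noteq> q powi (2 * l)) \<longrightarrow>
            K w (inverse q) = (1 - w) * psi2 w q + S5 w q)"
proof (intro conjI allI impI)
  have q0: "q \<noteq> 0" using assms(1) by auto
  have pow: "q * (q\<^sup>2) ^ j = q ^ (2 * j + 1)" "q\<^sup>2 * (q\<^sup>2) ^ j = q ^ (2 * (j + 1))" for j
    by (simp_all add: power_mult power_add power2_eq_square)
  {
    fix w :: complex assume w: "norm w > 1 \<and> (\<forall>l::nat. w \<noteq> q ^ (2 * l + 1))"
    define z where "z = inverse w"
    have w0: "w \<noteq> 0" and w1: "w \<noteq> 1" using w by auto
    have z: "norm z < 1" using w by (simp add: z_def norm_inverse inverse_less_1_iff)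
    have z1: "1 - z \<noteq> 0" using w0 w1 by (simp add: z_def)
    \<comment> \<open>The rescaling exchanges the factor 1 - z for the - z of
      \<open>kappa_inverse_base\<close>; with z = 1/w it equals 1/(1 - w).\<close>
    from sums_mult[OF kappa_series_sums[OF assms(2) z], of "- z / (1 - z)"]
    have "(\<lambda>m. - z * (z ^ m * (qpoch (z * q\<^sup>2) (q\<^sup>2) m / qpoch (z * q) (q\<^sup>2) (Suc m)))) sums (- z / (1 - z) * psi2 z q)"
      using z1 by simp
    then have "kappa w (inverse q) = - z / (1 - z) * psi2 z q"
      unfolding kappa_inverse_base[OF w0 q0] z_def[symmetric] by (rule sums_unique[symmetric])
    moreover have "- z / (1 - z) = 1 / (1 - w)"
      using w0 w1 z1 by (simp add: z_def divide_simps)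
    ultimately show "kappa w (inverse q) = 1 / (1 - w) * psi2 (inverse w) q" by (simp only: z_def)
  next
    fix w :: complex assume w: "w \<noteq> 0 \<and> w \<noteq> 1 \<and> (\<forall>l::int. w \<noteq> q powi (2 * l + 1))"
    then have w0: "w \<noteq> 0" and w1: "w \<noteq> 1" by auto
    have c: "1 - inverse w \<noteq> 0" using w1 by auto
    \<comment> \<open>Zeros of the denominators lie at the odd powers of q: negative exponents are
      ruled out by \<open>nw\<close>, positive ones by \<open>nv\<close>.\<close>
    have nw: "w * q * (q\<^sup>2) ^ j \<noteq> 1" for j
    proof
      assume "w * q * (q\<^sup>2) ^ j = 1"
      then have "w * q ^ (2 * j + 1) = 1" using pow(1)[of j] by (simp add: mult.assoc)
      then have "w = inverse (q ^ (2 * j + 1))" using q0 by (metis inverse_unique mult.commute)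
      also have "\<dots> = q powi (- int (2 * j + 1))" unfolding power_int_minus power_int_of_nat ..
      also have "- int (2 * j + 1) = 2 * (- int j - 1) + 1" by simp
      finally show False using w by blast
    qed
    have nv: "inverse w * q * (q\<^sup>2) ^ j \<noteq> 1" for j
    proof
      assume "inverse w * q * (q\<^sup>2) ^ j = 1"
      then have "w = q ^ (2 * j + 1)" using w0 pow(1)[of j] by (simp add: mult.assoc field_simps)
      also have "\<dots> = q powi int (2 * j + 1)" unfolding power_int_of_nat ..
      also have "int (2 * j + 1) = 2 * int j + 1" by simp
      finally show False using w by blast
    qed
    from sums_mult[OF K1_series_sums[OF q0 assms(2) w0 nw nv], of "inverse (1 - inverse w)"]
    have "K1 w (inverse q) = inverse (1 - inverse w) * (psi2 w q + s1 w q)"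
      unfolding K1_inverse_base[OF w0 q0] mult.assoc[symmetric] left_inverse[OF c] mult_1_left
      by (rule sums_unique[symmetric])
    moreover have "inverse (1 - inverse w) = w / (w - 1)"
      using w0 w1 c by (simp add: divide_simps)
    ultimately show "K1 w (inverse q) = w / (w - 1) * (psi2 w q + s1 w q)" by simp
  next
    fix w :: complex assume w: "w \<noteq> 0 \<and> (\<forall>l::int. l \<noteq> 0 \<longrightarrow> w \<noteq> q powi (2 * l))"
    then have w0: "w \<noteq> 0" by auto
    \<comment> \<open>The even exponents met here and in \<open>nv\<close> are -2(j + 1) and 2(j +
      1), never 0, so w = 1 stays admissible.\<close>
    have nw: "w * q\<^sup>2 * (q\<^sup>2) ^ j \<noteq> 1" for j
    proof
      assume "w * q\<^sup>2 * (q\<^sup>2) ^ j = 1"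
      then have "w * q ^ (2 * (j + 1)) = 1" using pow(2)[of j] by (simp add: mult.assoc)
      then have "w = inverse (q ^ (2 * (j + 1)))" using q0 by (metis inverse_unique mult.commute)
      also have "\<dots> = q powi (- int (2 * (j + 1)))" unfolding power_int_minus power_int_of_nat ..
      also have "- int (2 * (j + 1)) = 2 * (- int j - 1)" by simp
      finally show False using w[THEN conjunct2, THEN spec, of "- int j - 1"] by simp
    qed
    have nv: "inverse w * q\<^sup>2 * (q\<^sup>2) ^ j \<noteq> 1" for j
    proof
      assume "inverse w * q\<^sup>2 * (q\<^sup>2) ^ j = 1"
      then have "w = q ^ (2 * (j + 1))" using w0 pow(2)[of j] by (simp add: mult.assoc field_simps)
      also have "\<dots> = q powi int (2 * (j + 1))" unfolding power_int_of_nat ..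
      also have "int (2 * (j + 1)) = 2 * (int j + 1)" by simp
      finally show False using w[THEN conjunct2, THEN spec, of "int j + 1"] by simp
    qed
    show "K w (inverse q) = (1 - w) * psi2 w q + S5 w q"
      unfolding K_inverse_base[OF w0 q0]
      by (rule sums_unique[symmetric, OF K_series_sums[OF assms(2) w0 nw nv]])
  }
qed

end
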